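(* Let $E$ and $S$ be Polish spaces, let $I$ be a totally ordered set, and let $(\mathcal{B}_t(E))_{t\in I}$ (resp. $(\mathcal{B}_t(S))_{t\in I}$) be any filtration of the Borel sigma-field of $E$ (resp. of $S$). Let $\eta\in\mathcal{P}_E$ and $\nu\in\mathcal{P}_S$. Then: (i) $\Pi_c(\eta,\nu)$, the set of causal transference plans from $\eta$ to $\nu$, is a non-empty convex set, which is compact in $\mathcal{P}_{E\times S}$ for the topology of weak convergence in measure; (ii) $\mathcal{R}_a(\eta,\nu)$, the set of causal morphisms of probability spaces from $\eta$ to $\nu$, is closed in $\mathcal{R}(\eta,\nu)$ endowed with the topology of convergence in probability.
   Context: A filtration $(\mathcal{B}_t(E))_{t\in I}$ of the Borel sigma-field $\mathcal{B}(E)$ is a family of sigma-fields with $\mathcal{B}_s(E)\subset\mathcal{B}_t(E)\subset\mathcal{B}(E)$ for $s\le t$ in $I$ (similarly on $S$); no other property is assumed. For a Polish space $Z$, $\mathcal{P}_Z$ is the set of Borel probabilities on $Z$ with the topology of weak convergence in measure (convergence of integrals of functions in $C_b(Z)$). $f_\star\mathcal{P}$ denotes the pushforward of $\mathcal{P}$ by $f$. For a sigma-field $\mathcal{G}\subset\mathcal{B}(E)$ and $\eta\in\mathcal{P}_E$, $\mathcal{G}^\eta$ is its $\eta$-completion (the sigma-field generated by $\mathcal{G}$ and the $\eta$-negligible sets); $\eta$ also denotes its extension to $\mathcal{B}(E)^\eta$. $\pi:E\times S\to E$ and $\widetilde\pi:E\times S\to S$ are the projections. $\Pi(\eta,\nu)=\{\gamma\in\mathcal{P}_{E\times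 S}:\pi_\star\gamma=\eta,\ \widetilde\pi_\star\gamma=\nu\}$ (transference plans). A kernel associated to $\gamma\in\Pi(\eta,\nu)$ is a map $\Theta_\gamma:E\times\mathcal{B}(S)\to\mathbb{R}$, $(x,B)\mapsto\Theta_\gamma^x(B)$, with $\Theta^x_\gamma\in\mathcal{P}_S$ for all $x$, $x\mapsto\Theta^x_\gamma(B)$ Borel for all $B$, and $\gamma(A\times B)=\int_A\Theta^x_\gamma(B)\,d\eta(x)$ for all $A\in\mathcal{B}(E),B\in\mathcal{B}(S)$ (it exists and is $\eta$-a.s. unique). For $\gamma\in\Pi(\eta,\nu)$ and $t\in I$, $\mathcal{G}_t(\gamma)$ is the $\eta$-completion of the smallest sigma-field on $E$ making $x\mapsto\Theta^x_\gamma(C)$ measurable for every $C\in\mathcal{B}_t(S)$ with $\nu(\partial C)=0$ (it does not depend on the version of the kernel). The set of causal transference plans is $\Pi_c(\eta,\nu)=\{\gamma\in\Pi(\eta,\nu):\mathcal{G}_t(\gamma)\subset\mathcal{B}_t(E)^\eta\ \text{for all }t\in I\}$. $L^0(\eta,S)$ is the set of $\eta$-equivalence classes of $\mathcal{B}(E)^\eta/\mathcal{B}(S)$-measurable maps $E\to S$, with the (metrizable) topology of convergence in probability; $\mathcal{R}(\eta,\nu)=\{U\in L^0(\eta,S):U_\star\eta=\nu\}$. For $U\in L^0(\eta,S)$, $j(U)=(I_E\times U)_\star\eta$ is the law of $x\mapsto(x,U(x))$ under $\eta$. Finally $\mathcal{R}_a(\eta,\nu)=\{U\in\mathcal{R}(\eta,\nu):j(U)\in\Pi_c(\eta,\nu)\}$.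 *)

theory Defs
  imports "HOL-Probability.Probability"
begin

section \<open>Borel probabilities and weak convergence\<close>

abbreviation borel_probs :: "'a::topological_space measure set" where
  "borel_probs \<equiv> space (prob_algebra borel)"

lemma borel_probs_iff: "\<mu> \<in> borel_probs \<longleftrightarrow> sets \<mu> = sets borel \<and> prob_space \<mu>"
  by (auto simp: space_prob_algebra)

text \<open>The coarsest topology on \<^term>\<open>borel_probs\<close> for which the integrals of all bounded
  continuous functions are continuous: function types carry the product topology.\<close>

definition weak_topology :: "'a::topological_space measure topology" where
  "weak_topology =
     pullback_topology borel_probs (\<lambda>\<mu> (f :: 'a \<Rightarrow>\<^sub>C real). \<integral>x. f x \<partial>\<mu>) euclidean"

lemma topspace_weak_topology [simp]: "topspace weak_topology = borel_probs"
  by (simp add: weak_topology_def topspace_pullback_topology)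

lemma limitin_weak_topology_iff:
  fixes \<mu> :: "'a::topological_space measure"
  shows "limitin weak_topology \<mu>s \<mu> F \<longleftrightarrow>
     \<mu> \<in> borel_probs \<and> (\<forall>\<^sub>F i in F. \<mu>s i \<in> borel_probs) \<and>
     (\<forall>f :: 'a \<Rightarrow>\<^sub>C real. ((\<lambda>i. \<integral>x. f x \<partial>\<mu>s i) \<longlongrightarrow> (\<integral>x. f x \<partial>\<mu>)) F)"
proof -
  let ?I = "\<lambda>\<mu> (f :: 'a \<Rightarrow>\<^sub>C real). \<integral>x. f x \<partial>\<mu>"
  have "limitin weak_topology \<mu>s \<mu> F \<longleftrightarrow>
     \<mu> \<in> borel_probs \<and> (\<forall>\<^sub>F i in F. \<mu>s i \<in> borel_probs) \<and> ((\<lambda>i. ?I (\<mu>s i)) \<longlongrightarrow> ?I \<mu>) F"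
    (is "?L \<longleftrightarrow> ?R")
  proof
    assume L: ?L
    have 1: "\<mu> \<in> borel_probs" using limitin_topspace[OF L] by simp
    have "openin weak_topology (borel_probs :: 'a measure set)"
      by (metis openin_topspace topspace_weak_topology)
    then have 2: "\<forall>\<^sub>F i in F. \<mu>s i \<in> borel_probs" using L 1 by (auto simp: limitin_def)
    have "((\<lambda>i. ?I (\<mu>s i)) \<longlongrightarrow> ?I \<mu>) F"
    proof (rule topological_tendstoI)
      fix U :: "(('a \<Rightarrow>\<^sub>C real) \<Rightarrow> real) set" assume U: "open U" "?I \<mu> \<in> U"
      have "openin weak_topology (?I -` U \<inter> borel_probs)"
        unfolding weak_topology_def openin_pullback_topology using U(1) by auto
      then have "\<forall>\<^sub>F i in F. \<mu>s i \<in> ?I -` U \<inter> borel_probs" using L U(2) 1 by (auto simp: limitin_def)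
      then show "\<forall>\<^sub>F i in F. ?I (\<mu>s i) \<in> U" by eventually_elim auto
    qed
    with 1 2 show ?R by blast
  next
    assume R: ?R
    show ?L unfolding limitin_def
    proof (intro conjI allI impI)
      show "\<mu> \<in> topspace weak_topology" using R by simp
      fix W assume W: "openin weak_topology W \<and> \<mu> \<in> W"
      then obtain U where U: "open U" "W = ?I -` U \<inter> borel_probs"
        unfolding weak_topology_def openin_pullback_topology by auto
      have "\<forall>\<^sub>F i in F. ?I (\<mu>s i) \<in> U" using R U W by (auto intro: topological_tendstoD)
      moreover have "\<forall>\<^sub>F i in F. \<mu>s i \<in> borel_probs" using R by blast
      ultimately show "\<forall>\<^sub>F i in F. \<mu>s i \<in> W" by eventually_elim (auto simp: U(2))
    qed
  qed
  also have "((\<lambda>i. ?I (\<mu>s i)) \<longlongrightarrow> ?I \<mu>) F \<longleftrightarrow> (\<forall>f. ((\<lambda>i. ?I (\<mu>s i) f) \<longlongrightarrow> ?I \<mu> f) F)"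
    using limitin_componentwise[of "\<lambda>_. euclideanreal" UNIV "\<lambda>i. ?I (\<mu>s i)" "?I \<mu>" F]
    by (simp add: euclidean_product_topology)
  finally show ?thesis .
qed

definition mix_measure :: "real \<Rightarrow> 'a measure \<Rightarrow> 'a measure \<Rightarrow> 'a measure" where
  "mix_measure t \<mu> \<nu> = measure_of (space \<mu>) (sets \<mu>)
     (\<lambda>B. ennreal t * emeasure \<mu> B + ennreal (1 - t) * emeasure \<nu> B)"

lemma sets_mix_measure [simp]: "sets (mix_measure t \<mu> \<nu>) = sets \<mu>"
  by (simp add: mix_measure_def)

lemma emeasure_mix_measure:
  assumes "sets \<nu> = sets \<mu>" "B \<in> sets \<mu>"
  shows "emeasure (mix_measure t \<mu> \<nu>) B = ennreal t * emeasure \<mu> B + ennreal (1 - t) * emeasure \<nu> B"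
  unfolding mix_measure_def
proof (rule emeasure_measure_of_sigma[OF _ _ _ assms(2)])
  show "sigma_algebra (space \<mu>) (sets \<mu>)" by (rule sets.sigma_algebra_axioms)
  show "positive (sets \<mu>) (\<lambda>B. ennreal t * emeasure \<mu> B + ennreal (1 - t) * emeasure \<nu> B)"
    by (simp add: positive_def)
  show "countably_additive (sets \<mu>) (\<lambda>B. ennreal t * emeasure \<mu> B + ennreal (1 - t) * emeasure \<nu> B)"
    unfolding countably_additive_def using assms(1)
    by (auto simp: suminf_add[symmetric] suminf_emeasure)
qed

definition convex_measures :: "'a measure set \<Rightarrow> bool" where
  "convex_measures A \<longleftrightarrow> (\<forall>\<mu>\<in>A. \<forall>\<nu>\<in>A. \<forall>t\<in>{0..1}. mix_measure t \<mu> \<nu> \<in> A)"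


section \<open>Causal transference plans\<close>

definition borel_filtration :: "'i::linorder set \<Rightarrow> ('i \<Rightarrow> 'a::topological_space measure) \<Rightarrow> bool" where
  "borel_filtration I \<F> \<longleftrightarrow>
     (\<forall>t\<in>I. subalgebra borel (\<F> t)) \<and> (\<forall>s\<in>I. \<forall>t\<in>I. s \<le> t \<longrightarrow> sets (\<F> s) \<subseteq> sets (\<F> t))"

definition completed_sets :: "'a measure \<Rightarrow> 'a set set \<Rightarrow> 'a set set" where
  "completed_sets \<eta> \<G> = sigma_sets (space \<eta>) (\<G> \<union> {N. \<exists>N'\<in>null_sets \<eta>. N \<subseteq> N'})"

lemma completed_sets_sets: "completed_sets \<eta> (sets \<eta>) = sets (completion \<eta>)"
proof
  have "sets \<eta> \<union> {N. \<exists>N'\<in>null_sets \<eta>. N \<subseteq> N'} \<subseteq> sets (completion \<eta>)"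
    by (auto intro: sets_completionI_sub sets_completionI_sets)
  then show "completed_sets \<eta> (sets \<eta>) \<subseteq> sets (completion \<eta>)"
    unfolding completed_sets_def by (metis sets.sigma_sets_subset space_completion)
next
  show "sets (completion \<eta>) \<subseteq> completed_sets \<eta> (sets \<eta>)"
  proof
    fix A assume "A \<in> sets (completion \<eta>)"
    then obtain B N N' where *: "A = B \<union> N" "N \<subseteq> N'" "N' \<in> null_sets \<eta>" "B \<in> sets \<eta>"
      by (rule sets_completionE)
    then show "A \<in> completed_sets \<eta> (sets \<eta>)" unfolding completed_sets_def
      by (auto intro!: sigma_sets_Un)
  qed
qed

definition transference_plans ::
  "'a::topological_space measure \<Rightarrow> 'b::topological_space measure \<Rightarrow> ('a \<times> 'b) measure set" where
  "transference_plans \<eta> \<nu> = {\<gamma> \<in> borel_probs. distr \<gamma> borel fst = \<eta> \<and> distr \<gamma> borel snd = \<nu>}"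

definition is_kernel ::
  "'a::topological_space measure \<Rightarrow> ('a \<times> 'b::topological_space) measure \<Rightarrow> ('a \<Rightarrow> 'b measure) \<Rightarrow> bool" where
  "is_kernel \<eta> \<gamma> \<Theta> \<longleftrightarrow>
     (\<forall>x. \<Theta> x \<in> borel_probs) \<and>
     (\<forall>B\<in>sets borel. (\<lambda>x. measure (\<Theta> x) B) \<in> borel_measurable borel) \<and>
     (\<forall>A\<in>sets borel. \<forall>B\<in>sets borel. measure \<gamma> (A \<times> B) = (LINT x:A|\<eta>. measure (\<Theta> x) B))"

text \<open>On Polish spaces a kernel exists and is \<open>\<eta>\<close>-almost surely unique, so that
  \<open>causal_info\<close> below does not depend on the version chosen here.\<close>

definition kernel_of ::
  "'a::topological_space measure \<Rightarrow> ('a \<times> 'b::topological_space) measure \<Rightarrow> 'a \<Rightarrow> 'b measure" where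
  "kernel_of \<eta> \<gamma> = (SOME \<Theta>. is_kernel \<eta> \<gamma> \<Theta>)"

definition causal_info ::
  "'a::topological_space measure \<Rightarrow> 'b::topological_space measure \<Rightarrow> 'b measure \<Rightarrow>
   ('a \<times> 'b) measure \<Rightarrow> 'a set set" where
  "causal_info \<eta> \<nu> \<S> \<gamma> = completed_sets \<eta>
     (sigma_sets UNIV {(\<lambda>x. measure (kernel_of \<eta> \<gamma> x) C) -` D | C D.
        C \<in> sets \<S> \<and> measure \<nu> (frontier C) = 0 \<and> D \<in> sets (borel :: real measure)})"

definition causal_plans ::
  "'i set \<Rightarrow> ('i \<Rightarrow> 'a::topological_space measure) \<Rightarrow> ('i \<Rightarrow> 'b::topological_space measure) \<Rightarrow>
   'a measure \<Rightarrow> 'b measure \<Rightarrow> ('a \<times> 'b) measure set" where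
  "causal_plans I \<E> \<S> \<eta> \<nu> = {\<gamma> \<in> transference_plans \<eta> \<nu>.
     \<forall>t\<in>I. causal_info \<eta> \<nu> (\<S> t) \<gamma> \<subseteq> completed_sets \<eta> (sets (\<E> t))}"


section \<open>Random variables and convergence in probability\<close>

definition ae_eq_rel :: "'a measure \<Rightarrow> (('a \<Rightarrow> 'b::topological_space) \<times> ('a \<Rightarrow> 'b)) set" where
  "ae_eq_rel \<eta> = {(U, V). U \<in> completion \<eta> \<rightarrow>\<^sub>M borel \<and> V \<in> completion \<eta> \<rightarrow>\<^sub>M borel \<and>
     (AE x in completion \<eta>. U x = V x)}"

lemma equiv_ae_eq_rel:
  fixes \<eta> :: "'a measure"
  shows "equiv (completion \<eta> \<rightarrow>\<^sub>M borel) (ae_eq_rel \<eta> :: (('a \<Rightarrow> 'b::topological_space) \<times> _) set)"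
proof (rule equivI)
  show "trans (ae_eq_rel \<eta> :: (('a \<Rightarrow> 'b) \<times> _) set)"
  proof (rule transI)
    fix U V W :: "'a \<Rightarrow> 'b" assume "(U, V) \<in> ae_eq_rel \<eta>" "(V, W) \<in> ae_eq_rel \<eta>"
    then show "(U, W) \<in> ae_eq_rel \<eta>" unfolding ae_eq_rel_def
      by (auto elim: eventually_elim2)
  qed
qed (auto simp: ae_eq_rel_def refl_on_def sym_def eq_commute)

definition L0 :: "'a measure \<Rightarrow> ('a \<Rightarrow> 'b::topological_space) set set" where
  "L0 \<eta> = (completion \<eta> \<rightarrow>\<^sub>M borel) // ae_eq_rel \<eta>"

definition rep :: "('a \<Rightarrow> 'b) set \<Rightarrow> 'a \<Rightarrow> 'b" where
  "rep c = (SOME U. U \<in> c)"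

lemma rep_in: "c \<in> L0 \<eta> \<Longrightarrow> rep c \<in> c"
  unfolding rep_def L0_def by (metis equiv_ae_eq_rel in_quotient_imp_non_empty some_in_eq)

lemma L0_measurable: "c \<in> L0 \<eta> \<Longrightarrow> U \<in> c \<Longrightarrow> U \<in> completion \<eta> \<rightarrow>\<^sub>M borel"
  unfolding L0_def by (metis equiv_ae_eq_rel in_quotient_imp_subset subsetD)

lemma L0_AE_eq: "c \<in> L0 \<eta> \<Longrightarrow> U \<in> c \<Longrightarrow> V \<in> c \<Longrightarrow> AE x in completion \<eta>. U x = V x"
  using quotient_eq_iff[OF equiv_ae_eq_rel, of c \<eta> c U V]
  by (auto simp: L0_def ae_eq_rel_def)

lemma L0_eqI:
  assumes "c \<in> L0 \<eta>" "c' \<in> L0 \<eta>" "U \<in> c" "V \<in> c'" "AE x in completion \<eta>. U x = V x"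
  shows "c = c'"
  using quotient_eq_iff[OF equiv_ae_eq_rel, of c \<eta> c' U V] assms L0_measurable[OF assms(1,3)]
    L0_measurable[OF assms(2,4)]
  by (auto simp: L0_def ae_eq_rel_def)

text \<open>The usual metric of convergence in probability, see \<open>limitin_L0_topology_iff\<close>.\<close>

definition L0_dist :: "'a measure \<Rightarrow> ('a \<Rightarrow> 'b::metric_space) set \<Rightarrow> ('a \<Rightarrow> 'b) set \<Rightarrow> real" where
  "L0_dist \<eta> c c' = (\<integral>x. min 1 (dist (rep c x) (rep c' x)) \<partial>completion \<eta>)"

definition L0_topology :: "'a measure \<Rightarrow> ('a \<Rightarrow> 'b::metric_space) set topology" where
  "L0_topology \<eta> = Metric_space.mtopology (L0 \<eta>) (L0_dist \<eta>)"

lemma prob_space_completion: "prob_space \<eta> \<Longrightarrow> prob_space (completion \<eta>)"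
  by (metis emeasure_completion main_part_sets prob_space.emeasure_space_1 prob_spaceI
      sets.top space_completion main_part)

lemma integrable_L0_dist:
  fixes c c' :: "('a \<Rightarrow> 'b::{metric_space,second_countable_topology}) set"
  assumes "prob_space \<eta>" "c \<in> L0 \<eta>" "c' \<in> L0 \<eta>"
  shows "integrable (completion \<eta>) (\<lambda>x. min 1 (dist (rep c x) (rep c' x)))"
proof -
  interpret prob_space "completion \<eta>" using assms(1) by (rule prob_space_completion)
  have [measurable]: "rep c \<in> completion \<eta> \<rightarrow>\<^sub>M borel" "rep c' \<in> completion \<eta> \<rightarrow>\<^sub>M borel"
    using assms by (auto intro: L0_measurable rep_in)
  show ?thesis by (rule integrable_const_bound[where B=1]) auto
qed

lemma Metric_space_L0:
  assumes "prob_space \<eta>"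
  shows "Metric_space (L0 \<eta>) (L0_dist \<eta> :: ('a \<Rightarrow> 'b::{metric_space,second_countable_topology}) set \<Rightarrow> _)"
proof
  fix c c' c'' :: "('a \<Rightarrow> 'b) set"
  show "0 \<le> L0_dist \<eta> c c'" unfolding L0_dist_def by (rule Bochner_Integration.integral_nonneg) auto
  show "L0_dist \<eta> c c' = L0_dist \<eta> c' c" by (simp add: L0_dist_def dist_commute)
  assume c: "c \<in> L0 \<eta>" "c' \<in> L0 \<eta>"
  have "L0_dist \<eta> c c' = 0 \<longleftrightarrow> (AE x in completion \<eta>. min 1 (dist (rep c x) (rep c' x)) = 0)"
    unfolding L0_dist_def by (rule integral_nonneg_eq_0_iff_AE[OF integrable_L0_dist[OF assms c]]) auto
  also have "\<dots> \<longleftrightarrow> (AE x in completion \<eta>. rep c x = rep c' x)"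
    by (intro AE_cong) (auto simp: min_def)
  also have "\<dots> \<longleftrightarrow> c = c'" using L0_eqI[OF c rep_in rep_in] c by auto
  finally show "L0_dist \<eta> c c' = 0 \<longleftrightarrow> c = c'" .
  assume c'': "c'' \<in> L0 \<eta>"
  have "L0_dist \<eta> c c'' \<le> (\<integral>x. min 1 (dist (rep c x) (rep c' x)) + min 1 (dist (rep c' x) (rep c'' x)) \<partial>completion \<eta>)"
    unfolding L0_dist_def
  proof (rule integral_mono)
    fix x show "min 1 (dist (rep c x) (rep c'' x)) \<le>
       min 1 (dist (rep c x) (rep c' x)) + min 1 (dist (rep c' x) (rep c'' x))"
      using dist_triangle[of "rep c x" "rep c'' x" "rep c' x"]
        zero_le_dist[of "rep c x" "rep c' x"] zero_le_dist[of "rep c' x" "rep c'' x"]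
      by (smt (verit) min_def)
  qed (auto intro!: integrable_L0_dist assms c c'' Bochner_Integration.integrable_add)
  also have "\<dots> = L0_dist \<eta> c c' + L0_dist \<eta> c' c''" unfolding L0_dist_def
    by (intro Bochner_Integration.integral_add integrable_L0_dist assms c c'')
  finally show "L0_dist \<eta> c c'' \<le> L0_dist \<eta> c c' + L0_dist \<eta> c' c''" .
qed

lemma limitin_L0_topology_iff:
  fixes c :: "('a \<Rightarrow> 'b::{metric_space,second_countable_topology}) set"
  assumes \<eta>: "prob_space \<eta>" and cs: "\<And>n. cs n \<in> L0 \<eta>" "\<And>n. U n \<in> cs n" and c: "c \<in> L0 \<eta>" "V \<in> c"
  shows "limitin (L0_topology \<eta>) cs c sequentially \<longleftrightarrow>
    (\<forall>\<epsilon>>0. (\<lambda>n. measure (completion \<eta>) {x \<in> space \<eta>. dist (U n x) (V x) > \<epsilon>}) \<longlonglongrightarrow> 0)"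
proof -
  interpret P: prob_space "completion \<eta>" using \<eta> by (rule prob_space_completion)
  interpret M: Metric_space "L0 \<eta>" "L0_dist \<eta> :: ('a \<Rightarrow> 'b) set \<Rightarrow> _" by (rule Metric_space_L0[OF \<eta>])
  have mU [measurable]: "U n \<in> completion \<eta> \<rightarrow>\<^sub>M borel" for n using cs by (rule L0_measurable)
  have mV [measurable]: "V \<in> completion \<eta> \<rightarrow>\<^sub>M borel" using c by (rule L0_measurable)
  define p where "p \<epsilon> n = measure (completion \<eta>) {x \<in> space \<eta>. dist (U n x) (V x) > \<epsilon>}" for \<epsilon> n
  define d where "d n = (\<integral>x. min 1 (dist (U n x) (V x)) \<partial>completion \<eta>)" for n
  have m [measurable]: "{x \<in> space \<eta>. dist (U n x) (V x) > \<epsilon>} \<in> sets (completion \<eta>)" for n \<epsilon>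
  proof -
    have "{x \<in> space (completion \<eta>). dist (U n x) (V x) > \<epsilon>} \<in> sets (completion \<eta>)" by measurable
    then show ?thesis by simp
  qed
  have int: "integrable (completion \<eta>) (\<lambda>x. min 1 (dist (U n x) (V x)))" for n
    by (rule P.integrable_const_bound[where B=1]) auto
  have d: "L0_dist \<eta> (cs n) c = d n" for n
  proof -
    have "AE x in completion \<eta>. rep (cs n) x = U n x" "AE x in completion \<eta>. rep c x = V x"
      using cs c by (auto intro: L0_AE_eq rep_in)
    then have ae: "AE x in completion \<eta>. min 1 (dist (rep (cs n) x) (rep c x)) = min 1 (dist (U n x) (V x))"
      by eventually_elim simp
    have [measurable]: "rep (cs n) \<in> completion \<eta> \<rightarrow>\<^sub>M borel" "rep c \<in> completion \<eta> \<rightarrow>\<^sub>M borel"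
      using cs c by (auto intro: L0_measurable rep_in)
    show ?thesis unfolding L0_dist_def d_def by (rule integral_cong_AE[OF _ _ ae]) measurable
  qed
  have d0: "0 \<le> d n" for n unfolding d_def by (rule Bochner_Integration.integral_nonneg) auto
  have p0: "0 \<le> p \<epsilon> n" for \<epsilon> n by (simp add: p_def)
  have ind: "(\<integral>x. a * indicator {x \<in> space \<eta>. dist (U n x) (V x) > \<epsilon>} x \<partial>completion \<eta>) = a * p \<epsilon> n"
    "integrable (completion \<eta>) (\<lambda>x. a * indicator {x \<in> space \<eta>. dist (U n x) (V x) > \<epsilon>} x :: real)" for a \<epsilon> n
    by (auto simp: p_def P.emeasure_eq_measure Int_def conj_commute)
  have lower: "min 1 \<epsilon> * p \<epsilon> n \<le> d n" if "\<epsilon> > 0" for \<epsilon> n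
  proof -
    have "(\<integral>x. min 1 \<epsilon> * indicator {x \<in> space \<eta>. dist (U n x) (V x) > \<epsilon>} x \<partial>completion \<eta>) \<le> d n"
      unfolding d_def by (intro integral_mono int ind) (auto simp: indicator_def min_def)
    then show ?thesis by (simp only: ind)
  qed
  have upper: "d n \<le> \<epsilon> + p \<epsilon> n" if "\<epsilon> > 0" for \<epsilon> n
  proof -
    have "d n \<le> (\<integral>x. \<epsilon> + 1 * indicator {x \<in> space \<eta>. dist (U n x) (V x) > \<epsilon>} x \<partial>completion \<eta>)"
      unfolding d_def using that
      by (intro integral_mono int ind Bochner_Integration.integrable_add) (auto simp: indicator_def min_def)
    also have "\<dots> = \<epsilon> + 1 * p \<epsilon> n"
      using P.prob_space by (subst Bochner_Integration.integral_add) (auto simp only: ind integrable_const P.integrable_const lebesgue_integral_const scaleR_one)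
    finally show ?thesis by simp
  qed
  have "limitin (L0_topology \<eta>) cs c sequentially \<longleftrightarrow> d \<longlonglongrightarrow> 0"
    unfolding L0_topology_def M.limit_metric_sequentially lim_sequentially
    using cs c d0 by (simp add: d)
  also have "\<dots> \<longleftrightarrow> (\<forall>\<epsilon>>0. p \<epsilon> \<longlonglongrightarrow> 0)"
  proof (intro iffI allI impI)
    fix \<epsilon> :: real assume A: "d \<longlonglongrightarrow> 0" "\<epsilon> > 0"
    have "(\<lambda>n. d n / min 1 \<epsilon>) \<longlonglongrightarrow> 0" using tendsto_divide[OF A(1) tendsto_const[of "min 1 \<epsilon>"]] A(2) by simp
    then show "p \<epsilon> \<longlonglongrightarrow> 0"
      by (rule tendsto_sandwich[OF _ _ tendsto_const, rotated 2])
        (use A(2) lower in \<open>auto simp: p0 pos_le_divide_eq mult.commute\<close>)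
  next
    assume A: "\<forall>\<epsilon>>0. p \<epsilon> \<longlonglongrightarrow> 0"
    show "d \<longlonglongrightarrow> 0"
    proof (rule LIMSEQ_I)
      fix r :: real assume r: "r > 0"
      then have "\<forall>\<^sub>F n in sequentially. p (r/2) n < r/2" using A order_tendstoD(2)[of "p (r/2)" 0 sequentially "r/2"] by simp
      then obtain N where "\<forall>n\<ge>N. p (r/2) n < r/2" by (auto simp: eventually_sequentially)
      then show "\<exists>N. \<forall>n\<ge>N. norm (d n - 0) < r"
        using upper[of "r/2"] r d0 by (intro exI[of _ N]) (smt (verit) real_norm_def field_sum_of_halves)
    qed
  qed
  finally show ?thesis unfolding p_def .
qed

definition R_maps :: "'a measure \<Rightarrow> 'b::topological_space measure \<Rightarrow> ('a \<Rightarrow> 'b) set set" where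
  "R_maps \<eta> \<nu> = {c \<in> L0 \<eta>. distr (completion \<eta>) borel (rep c) = \<nu>}"

definition graph_plan ::
  "'a::topological_space measure \<Rightarrow> ('a \<Rightarrow> 'b::topological_space) set \<Rightarrow> ('a \<times> 'b) measure" where
  "graph_plan \<eta> c = distr (completion \<eta>) borel (\<lambda>x. (x, rep c x))"

lemma distr_rep:
  assumes "c \<in> L0 \<eta>" "U \<in> c"
  shows "distr (completion \<eta>) borel (rep c) = distr (completion \<eta>) borel U"
  by (rule distr_cong_AE) (use assms in \<open>auto intro: L0_AE_eq L0_measurable rep_in\<close>)

lemma graph_plan_rep:
  fixes \<eta> :: "'a::second_countable_topology measure"
    and c :: "('a \<Rightarrow> 'b::second_countable_topology) set"
  assumes "sets \<eta> = sets borel" "c \<in> L0 \<eta>" "U \<in> c"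
  shows "graph_plan \<eta> c = distr (completion \<eta>) borel (\<lambda>x. (x, U x))"
  unfolding graph_plan_def
proof (rule distr_cong_AE)
  have [measurable]: "(\<lambda>x. x) \<in> completion \<eta> \<rightarrow>\<^sub>M borel"
    using assms(1) by (intro measurable_completion) (simp add: measurable_ident_sets)
  have [measurable]: "rep c \<in> completion \<eta> \<rightarrow>\<^sub>M borel" "U \<in> completion \<eta> \<rightarrow>\<^sub>M borel"
    using assms by (auto intro: L0_measurable rep_in)
  show "(\<lambda>x. (x, rep c x)) \<in> completion \<eta> \<rightarrow>\<^sub>M borel" "(\<lambda>x. (x, U x)) \<in> completion \<eta> \<rightarrow>\<^sub>M borel"
    by (simp_all add: borel_prod[symmetric])
  have "AE x in completion \<eta>. rep c x = U x" using assms by (auto intro: L0_AE_eq rep_in)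
  then show "AE x in completion \<eta>. (x, rep c x) = (x, U x)" by eventually_elim simp
qed simp_all

definition causal_maps ::
  "'i set \<Rightarrow> ('i \<Rightarrow> 'a::topological_space measure) \<Rightarrow> ('i \<Rightarrow> 'b::topological_space measure) \<Rightarrow>
   'a measure \<Rightarrow> 'b measure \<Rightarrow> ('a \<Rightarrow> 'b) set set" where
  "causal_maps I \<E> \<S> \<eta> \<nu> = {c \<in> R_maps \<eta> \<nu>. graph_plan \<eta> c \<in> causal_plans I \<E> \<S> \<eta> \<nu>}"

end

theory Submission
  imports Defs
begin

text \<open>A plan with marginals \<open>\<eta>\<close> and \<open>\<nu>\<close> is the same thing as a bimeasure, a function of two sets that is
  additive in each of them and has these marginals: domination by the marginals gives countable
  additivity, and embedding \<open>S\<close> in the real line, where conditional distribution functions yield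
  a kernel, gives the disintegration. Bimeasures form a closed set in a product of unit intervals,
  hence a compact one, and integrals of bounded continuous functions depend continuously on the
  bimeasure, because a nonnegative continuous function is a countable supremum of weighted rectangles
  and its integral is therefore lower semicontinuous. This replaces Prokhorov's theorem.

  A plan is causal iff \<open>\<gamma>(A \<times> C)\<close> equals the \<open>\<gamma>\<close>-integral of \<open>E[1\<^sub>A | \<B>\<^sub>t(E)](x) 1\<^sub>C(y)\<close> for all \<open>A\<close> and
  the relevant \<open>C\<close>, \<open>t\<close>. These conditions are affine in \<open>\<gamma>\<close>, hold for the product measure, and are
  continuous in the bimeasure even for discontinuous integrands since the marginals are fixed;
  this gives (i). For (ii), \<open>j\<close> is continuous from convergence in probability to weak convergence and the causal
  plans are closed, being compact in a Hausdorff space.\<close>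

section \<open>Polish spaces as Borel retracts of the real line\<close>

text \<open>Two obstacles shape the argument. Causality is a condition on the kernel, which is only
  determined almost surely and does not vary continuously with the plan. Self-adjointness of
  conditional expectation removes it: a function f with values in [0,1] is measurable for the
  completion of F iff f = E[f | F] almost surely, and tested against 1_A this says that the
  integrals of f 1_A and of E[1_A | F] f agree. For f(x) = \<Theta>^x(C) both are integrals against
  \<gamma>, and the expectation now falls on a function that does not depend on \<gamma>. The second
  obstacle is that E[1_A | F](x) 1_C(y) is usually discontinuous, so weak convergence does not
  control its integral directly. In the topology of values on rectangles the integral is lower
  semicontinuous, and so is that of (1 - E[1_A | F](x)) 1_C(y); the two add up to the constant
  \<nu>(C), so both are continuous.\<close>

text \<open>A point is coded by the balls containing it; digits 0 and 1 in base 3 have no carries.\<close>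

definition bits_real :: "(nat \<Rightarrow> bool) \<Rightarrow> real" where
  "bits_real b = (\<Sum>i. of_bool (b i) * (1/3) ^ Suc i)"

definition real_bit :: "nat \<Rightarrow> real \<Rightarrow> bool" where
  "real_bit j r \<longleftrightarrow> \<lfloor>3 ^ Suc j * r\<rfloor> mod 3 = 1"

lemma summable_bits: "summable (\<lambda>i. of_bool (b i) * (1/3 :: real) ^ Suc i)"
  by (rule summable_comparison_test'[of "\<lambda>i. (1/3 :: real) ^ Suc i" 0])
     (auto simp: summable_Suc_iff intro: summable_geometric)

text \<open>Even with all digits equal to 1 the value is 1/2, so a tail never reaches 1 and cannot
  disturb the integer part that \<open>real_bit\<close> reads.\<close>

lemma bits_real_bounds: "0 \<le> bits_real b" "bits_real b < 1"
proof -
  have s: "(\<lambda>i. (1/3 :: real) ^ Suc i) sums (1/2)"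
    using sums_mult[OF geometric_sums[of "1/3::real"], of "1/3"] by simp
  show "0 \<le> bits_real b" unfolding bits_real_def by (intro suminf_nonneg summable_bits) auto
  have "bits_real b \<le> (\<Sum>i. (1/3 :: real) ^ Suc i)" unfolding bits_real_def
    by (intro suminf_le summable_bits sums_summable[OF s]) auto
  also have "\<dots> = 1/2" using s by (rule sums_unique[symmetric])
  finally show "bits_real b < 1" by simp
qed

text \<open>Scaling by \<open>3 ^ Suc j\<close> puts digit j in the unit place, turns the earlier
  digits into the multiple k of 3, and leaves as fractional part a tail that is itself a value of
  \<open>bits_real\<close>.\<close>

lemma real_bit_bits_real: "real_bit j (bits_real b) = b j"
proof -
  define k :: int where "k = (\<Sum>i<j. of_bool (b i) * 3 ^ (j - i))"
  have "bits_real b = (\<Sum>i. of_bool (b (i + Suc j)) * (1/3) ^ Suc (i + Suc j)) +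
      (\<Sum>i<Suc j. of_bool (b i) * (1/3) ^ Suc i)"
    unfolding bits_real_def by (rule suminf_split_initial_segment[OF summable_bits])
  also have "(\<Sum>i. of_bool (b (i + Suc j)) * (1/3 :: real) ^ Suc (i + Suc j)) =
      (1/3) ^ Suc j * bits_real (\<lambda>i. b (i + Suc j))"
    unfolding bits_real_def
    by (subst suminf_mult[OF summable_bits, symmetric]) (simp add: power_add mult_ac)
  finally have "3 ^ Suc j * bits_real b =
     bits_real (\<lambda>i. b (i + Suc j)) + (\<Sum>i<Suc j. of_bool (b i) * (3 ^ Suc j * (1/3) ^ Suc i))"
    by (simp add: ring_distribs sum_distrib_left mult_ac power_divide del: sum.lessThan_Suc)
  also have "(\<Sum>i<Suc j. of_bool (b i) * (3 ^ Suc j * (1/3 :: real) ^ Suc i)) =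
      (\<Sum>i<Suc j. of_bool (b i) * 3 ^ (j - i))"
    by (intro sum.cong refl) (auto simp: power_diff power_divide)
  also have "\<dots> = of_int (k + of_bool (b j))" by (simp add: k_def)
  finally have "\<lfloor>3 ^ Suc j * bits_real b\<rfloor> = k + of_bool (b j)"
    using bits_real_bounds[of "\<lambda>i. b (i + Suc j)"] by linarith
  moreover have "3 dvd k" unfolding k_def by (intro dvd_sum dvd_mult) (auto simp: dvd_power)
  ultimately show ?thesis unfolding real_bit_def
    by (cases "b j") (auto simp: mod_add_eq[symmetric] dvd_eq_mod_eq_0)
qed

lemma measurable_real_bit [measurable]: "Measurable.pred borel (real_bit j)"
  unfolding real_bit_def by measurable

lemma borel_measurable_bits_real:
  assumes [measurable]: "\<And>i. Measurable.pred M (\<lambda>x. b x i)"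
  shows "(\<lambda>x. bits_real (b x)) \<in> borel_measurable M"
  unfolding bits_real_def of_bool_def by measurable

text \<open>\<open>\<phi>\<close> records for all n and k whether the point is within
  \<open>(1/2) ^ n\<close> of the k-th point of a dense sequence; \<open>\<psi>\<close> takes for
  each n the first centre so recorded and passes to the limit. A Borel left inverse is what carries
  kernels on the real line back to the Polish space.\<close>

proposition polish_retract_of_real:
  obtains \<phi> :: "'a::polish_space \<Rightarrow> real" and \<psi> :: "real \<Rightarrow> 'a"
  where "\<phi> \<in> borel_measurable borel" "\<psi> \<in> borel_measurable borel"
    "\<And>y. \<psi> (\<phi> y) = y" "\<And>y. 0 \<le> \<phi> y \<and> \<phi> y < 1"
proof -
  obtain D :: "'a set" where D: "countable D" "\<And>X. open X \<Longrightarrow> X \<noteq> {} \<Longrightarrow> \<exists>d\<in>D. d \<in> X"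
    using countable_dense_setE by blast
  define s where "s = from_nat_into D"
  have "D \<noteq> {}" using D(2)[of UNIV] by auto
  then have s: "\<exists>k. dist y (s k) < e" if "e > 0" for y e
    using D(2)[of "ball y e"] that D(1) unfolding s_def
    by (metis centre_in_ball empty_iff from_nat_into_surj mem_ball open_ball)
  define b where "b y i = (case prod_decode i of (n, k) \<Rightarrow> dist y (s k) < (1/2) ^ n)" for y i
  define \<phi> where "\<phi> y = bits_real (b y)" for y
  define K where "K n r = (LEAST k. real_bit (prod_encode (n, k)) r)" for n r
  \<comment> \<open>The Cauchy test makes \<open>\<psi>\<close> total and, by completeness, a
    pointwise limit of Borel functions; \<open>s 0\<close> is an arbitrary default off the Cauchy
    set.\<close>
  define \<psi> where "\<psi> r = (if Cauchy (\<lambda>n. s (K n r)) then lim (\<lambda>n. s (K n r)) else s 0)" for r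
  have [measurable]: "(\<lambda>r. s (K n r)) \<in> borel_measurable borel" for n
    unfolding K_def by measurable
  have "\<psi> \<in> borel_measurable borel"
  proof (rule borel_measurable_LIMSEQ_metric)
    fix n show "(\<lambda>r. if Cauchy (\<lambda>n. s (K n r)) then s (K n r) else s 0) \<in> borel_measurable borel"
      by measurable
  next
    fix r show "(\<lambda>n. if Cauchy (\<lambda>n. s (K n r)) then s (K n r) else s 0) \<longlonglongrightarrow> \<psi> r"
      unfolding \<psi>_def using Cauchy_convergent convergent_LIMSEQ_iff by auto
  qed
  moreover have "\<phi> \<in> borel_measurable borel"
    unfolding \<phi>_def b_def by (intro borel_measurable_bits_real) (auto split: prod.split)
  moreover have "\<psi> (\<phi> y) = y" for y
  proof -
    have bit: "real_bit (prod_encode (n, k)) (\<phi> y) \<longleftrightarrow> dist y (s k) < (1/2) ^ n" for n k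
      by (simp add: \<phi>_def real_bit_bits_real b_def)
    have "dist y (s (K n (\<phi> y))) < (1/2) ^ n" for n
      unfolding K_def bit using s[of "(1/2) ^ n" y] by (auto intro: LeastI_ex)
    then have "(\<lambda>n. dist (s (K n (\<phi> y))) y) \<longlonglongrightarrow> 0"
      by (intro tendsto_sandwich[OF _ _ tendsto_const LIMSEQ_realpow_zero[of "1/2"]])
         (auto simp: dist_commute less_imp_le)
    then have "(\<lambda>n. s (K n (\<phi> y))) \<longlonglongrightarrow> y" by (rule tendsto_dist_iff[THEN iffD2])
    then show ?thesis unfolding \<psi>_def
      using LIMSEQ_imp_Cauchy limI by auto
  qed
  ultimately show thesis using that[of \<phi> \<psi>] bits_real_bounds by (auto simp: \<phi>_def)
qed

section \<open>Bimeasures and their disintegration\<close>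

text \<open>Domination by a finite measure forces continuity at the empty set, which for a finite,
  finitely additive function amounts to countable additivity.\<close>

lemma dominated_additive_measure:
  fixes f :: "'a set \<Rightarrow> real"
  assumes M: "finite_measure M"
    and nonneg: "\<And>A. A \<in> sets M \<Longrightarrow> 0 \<le> f A"
    and add: "\<And>A B. A \<in> sets M \<Longrightarrow> B \<in> sets M \<Longrightarrow> A \<inter> B = {} \<Longrightarrow> f (A \<union> B) = f A + f B"
    and le: "\<And>A. A \<in> sets M \<Longrightarrow> f A \<le> measure M A"
  obtains L where "finite_measure L" "sets L = sets M" "\<And>A. A \<in> sets M \<Longrightarrow> measure L A = f A"
proof -
  interpret finite_measure M by (rule M)
  have f0: "f {} = 0" using le[of "{}"] nonneg[of "{}"] by simp
  have ca: "countably_additive (sets M) (\<lambda>A. ennreal (f A))"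
  proof (rule sets.empty_continuous_imp_countably_additive)
    show "positive (sets M) (\<lambda>A. ennreal (f A))" by (simp add: positive_def f0)
    show "additive (sets M) (\<lambda>A. ennreal (f A))" by (simp add: additive_def add nonneg)
    fix A :: "nat \<Rightarrow> 'a set" assume A: "range A \<subseteq> sets M" "decseq A" "(\<Inter>i. A i) = {}"
    have "(\<lambda>i. measure M (A i)) \<longlonglongrightarrow> 0"
      using finite_Lim_measure_decseq[OF A(1,2)] A(3) by simp
    then have "(\<lambda>i. f (A i)) \<longlonglongrightarrow> 0"
      by (rule tendsto_sandwich[OF _ _ tendsto_const, rotated 2]) (use A nonneg le in auto)
    then show "(\<lambda>i. ennreal (f (A i))) \<longlonglongrightarrow> 0"
      by (metis ennreal_0 tendsto_ennrealI)
  qed simp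
  define L where "L = measure_of (space M) (sets M) (\<lambda>A. ennreal (f A))"
  have L: "sets L = sets M" by (simp add: L_def)
  have em: "emeasure L A = ennreal (f A)" if "A \<in> sets M" for A
    unfolding L_def
    by (rule emeasure_measure_of_sigma[OF sets.sigma_algebra_axioms _ ca that]) (simp add: positive_def f0)
  show thesis
  proof
    show "finite_measure L"
      by (rule finite_measureI) (simp add: em sets_eq_imp_space_eq[OF L])
  qed (use L em nonneg in \<open>auto simp: measure_def\<close>)
qed

text \<open>The set where \<open>g < f\<close> is itself a test set; on it the nonnegative function
  f - g has integral at most 0, hence vanishes almost surely.\<close>

lemma AE_leI_integral:
  fixes f g :: "'a \<Rightarrow> real"
  assumes [measurable]: "integrable M f" "integrable M g"
    and le: "\<And>A. A \<in> sets M \<Longrightarrow> (\<integral>x. f x * indicator A x \<partial>M) \<le> (\<integral>x. g x * indicator A x \<partial>M)"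
  shows "AE x in M. f x \<le> g x"
proof -
  define A where "A = {x\<in>space M. g x < f x}"
  have [measurable]: "A \<in> sets M" unfolding A_def by measurable
  have i: "integrable M (\<lambda>x. f x * indicator A x)" "integrable M (\<lambda>x. g x * indicator A x)"
    by (auto intro!: integrable_real_mult_indicator assms)
  have nn: "AE x in M. 0 \<le> f x * indicator A x - g x * indicator A x"
    by (rule AE_I2) (auto simp: A_def indicator_def)
  have "(\<integral>x. f x * indicator A x - g x * indicator A x \<partial>M) \<le> 0"
    using le[of A] by (subst Bochner_Integration.integral_diff[OF i]) auto
  moreover have "0 \<le> (\<integral>x. f x * indicator A x - g x * indicator A x \<partial>M)"
    using nn by (rule integral_nonneg_AE)
  ultimately have "(\<integral>x. f x * indicator A x - g x * indicator A x \<partial>M) = 0" by simp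
  then have "AE x in M. f x * indicator A x - g x * indicator A x = 0"
    using integral_nonneg_eq_0_iff_AE[OF Bochner_Integration.integrable_diff[OF i] nn] by simp
  then show ?thesis
    using AE_space by eventually_elim (auto simp: A_def indicator_def not_less split: if_splits)
qed

lemma AE_eqI_integral:
  fixes f g :: "'a \<Rightarrow> real"
  assumes "integrable M f" "integrable M g"
    and "\<And>A. A \<in> sets M \<Longrightarrow> (\<integral>x. f x * indicator A x \<partial>M) = (\<integral>x. g x * indicator A x \<partial>M)"
  shows "AE x in M. f x = g x"
  using AE_leI_integral[of M f g] AE_leI_integral[of M g f] assms by fastforce

text \<open>Only finite additivity is demanded: each condition then concerns finitely many values of
  \<open>\<beta>\<close> and survives pointwise limits, which countable additivity in general does
  not. Taking a pair as the single argument makes \<open>\<beta>\<close> a point of a product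
  space.\<close>

locale bimeasure = M: prob_space M + N: prob_space N
  for M :: "'a measure" and N :: "'b measure" +
  fixes \<beta> :: "'a set \<times> 'b set \<Rightarrow> real"
  assumes nonneg: "A \<in> sets M \<Longrightarrow> B \<in> sets N \<Longrightarrow> 0 \<le> \<beta> (A, B)"
    and add_left: "A \<in> sets M \<Longrightarrow> A' \<in> sets M \<Longrightarrow> A \<inter> A' = {} \<Longrightarrow> B \<in> sets N \<Longrightarrow>
      \<beta> (A \<union> A', B) = \<beta> (A, B) + \<beta> (A', B)"
    and add_right: "A \<in> sets M \<Longrightarrow> B \<in> sets N \<Longrightarrow> B' \<in> sets N \<Longrightarrow> B \<inter> B' = {} \<Longrightarrow>
      \<beta> (A, B \<union> B') = \<beta> (A, B) + \<beta> (A, B')"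
    and marginal_left: "A \<in> sets M \<Longrightarrow> \<beta> (A, space N) = measure M A"
    and marginal_right: "B \<in> sets N \<Longrightarrow> \<beta> (space M, B) = measure N B"
begin

lemma le_left:
  assumes "A \<in> sets M" "B \<in> sets N" shows "\<beta> (A, B) \<le> measure M A"
  using add_right[of A B "space N - B"] nonneg[of A "space N - B"] marginal_left assms
    sets.sets_into_space[OF assms(2)]
  by (auto simp: Un_absorb1)

lemma le_right:
  assumes "A \<in> sets M" "B \<in> sets N" shows "\<beta> (A, B) \<le> measure N B"
  using add_left[of A "space M - A" B] nonneg[of "space M - A" B] marginal_right assms
    sets.sets_into_space[OF assms(1)]
  by (auto simp: Un_absorb1)

lemma mono_right:
  assumes "A \<in> sets M" "B \<in> sets N" "B' \<in> sets N" "B \<subseteq> B'" shows "\<beta> (A, B) \<le> \<beta> (A, B')"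
  using add_right[of A B "B' - B"] nonneg[of A "B' - B"] assms by (auto simp: Un_absorb1)

lemma right_measure:
  assumes A: "A \<in> sets M"
  obtains L where "finite_measure L" "sets L = sets N" "\<And>B. B \<in> sets N \<Longrightarrow> measure L B = \<beta> (A, B)"
  by (rule dominated_additive_measure[OF N.finite_measure_axioms, of "\<lambda>B. \<beta> (A, B)"])
     (use A nonneg add_right le_right in auto)

text \<open>Radon-Nikodym for the measure A -> \<open>\<beta> (A, B)\<close>, which M dominates. The
  bounds hold at every point, as the construction of distribution functions below requires.\<close>

lemma left_density:
  assumes B: "B \<in> sets N"
  obtains g where "g \<in> borel_measurable M" "\<And>x. 0 \<le> g x" "\<And>x. g x \<le> 1"
    "\<And>A. A \<in> sets M \<Longrightarrow> \<beta> (A, B) = (\<integral>x. g x * indicator A x \<partial>M)"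
proof -
  obtain L where L: "finite_measure L" "sets L = sets M" "\<And>A. A \<in> sets M \<Longrightarrow> measure L A = \<beta> (A, B)"
    by (rule dominated_additive_measure[OF M.finite_measure_axioms, of "\<lambda>A. \<beta> (A, B)"])
       (use B nonneg add_left le_left in auto)
  interpret L: finite_measure L by fact
  have "absolutely_continuous M L"
  proof (unfold absolutely_continuous_def, rule subsetI)
    fix A assume A: "A \<in> null_sets M"
    then have "measure L A \<le> measure M A" using L(3) le_left B by auto
    also have "\<dots> = 0" using A by (auto simp: measure_def)
    finally show "A \<in> null_sets L" using A L(2)
      by (auto simp: null_sets_def L.emeasure_eq_measure measure_le_0_iff)
  qed
  then obtain f where f [measurable]: "f \<in> borel_measurable M" and fL: "density M f = L"
    using M.Radon_Nikodym[of L] L(2) by auto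
  have emf: "(\<integral>\<^sup>+x. f x * indicator A x \<partial>M) = ennreal (\<beta> (A, B))" if "A \<in> sets M" for A
    using emeasure_density[OF f that] that by (simp add: fL L.emeasure_eq_measure L(3))
  have "AE x in M. f x \<noteq> \<infinity>"
    by (rule nn_integral_PInf_AE) (use emf[of "space M"] in \<open>auto cong: nn_integral_cong\<close>)
  then have fr: "AE x in M. f x = ennreal (enn2real (f x))"
    by eventually_elim (simp add: less_top)
  have int: "(\<integral>x. enn2real (f x) * indicator A x \<partial>M) = \<beta> (A, B)"
    and intble: "integrable M (\<lambda>x. enn2real (f x) * indicator A x)" if [measurable]: "A \<in> sets M" for A
  proof -
    have "(\<integral>\<^sup>+x. ennreal (enn2real (f x) * indicator A x) \<partial>M) = (\<integral>\<^sup>+x. f x * indicator A x \<partial>M)"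
      by (intro nn_integral_cong_AE) (use fr in eventually_elim, auto simp: indicator_def)
    then have "(\<integral>\<^sup>+x. ennreal (enn2real (f x) * indicator A x) \<partial>M) = ennreal (\<beta> (A, B))"
      using emf that by simp
    then show "(\<integral>x. enn2real (f x) * indicator A x \<partial>M) = \<beta> (A, B)"
      "integrable M (\<lambda>x. enn2real (f x) * indicator A x)"
      using nonneg[OF that B] by (auto intro!: integral_eq_nn_integral[THEN trans] integrableI_nonneg)
  qed
  \<comment> \<open>By domination the density is at most 1 almost surely, so truncation changes no
    integral.\<close>
  define g where "g x = min 1 (enn2real (f x))" for x
  have [measurable]: "g \<in> borel_measurable M" unfolding g_def by measurable
  have "integrable M (\<lambda>x. enn2real (f x))"
    using intble[of "space M"] by (auto cong: Bochner_Integration.integrable_cong)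
  then have "AE x in M. enn2real (f x) \<le> 1"
    by (rule AE_leI_integral) (use int le_left B in \<open>auto simp: measure_def\<close>)
  then have gf: "AE x in M. g x = enn2real (f x)" by eventually_elim (simp add: g_def)
  show thesis
  proof
    fix A assume A [measurable]: "A \<in> sets M"
    have "(\<integral>x. g x * indicator A x \<partial>M) = (\<integral>x. enn2real (f x) * indicator A x \<partial>M)"
      by (intro integral_cong_AE) (use gf in \<open>auto elim: eventually_mono\<close>)
    then show "\<beta> (A, B) = (\<integral>x. g x * indicator A x \<partial>M)" using int A by simp
  qed (auto simp: g_def)
qed

text \<open>This replaces the second factor by the real line; h will be the embedding
  \<open>\<phi>\<close>.\<close>

lemma bimeasure_image:
  assumes h [measurable]: "h \<in> N \<rightarrow>\<^sub>M K"
  shows "bimeasure M (distr N K h) (\<lambda>(A, B). \<beta> (A, h -` B \<inter> space N))"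
proof (intro bimeasure.intro bimeasure_axioms.intro)
  show "prob_space (distr N K h)" by (rule N.prob_space_distr[OF h])
  fix A :: "'a set" and B B' :: "'c set"
  assume A: "A \<in> sets M" and B: "B \<in> sets (distr N K h)" "B' \<in> sets (distr N K h)" "B \<inter> B' = {}"
  have "\<beta> (A, h -` B \<inter> space N \<union> h -` B' \<inter> space N) =
    \<beta> (A, h -` B \<inter> space N) + \<beta> (A, h -` B' \<inter> space N)"
    using A B by (intro add_right) (auto simp: measurable_sets[OF h])
  then show "(case (A, B \<union> B') of (A, B) \<Rightarrow> \<beta> (A, h -` B \<inter> space N)) =
    (case (A, B) of (A, B) \<Rightarrow> \<beta> (A, h -` B \<inter> space N)) +
    (case (A, B') of (A, B) \<Rightarrow> \<beta> (A, h -` B \<inter> space N))"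
    by (simp add: Int_Un_distrib2)
next
  fix A assume "A \<in> sets M"
  moreover have "h -` space K \<inter> space N = space N" using measurable_space[OF h] by auto
  ultimately show "(case (A, space (distr N K h)) of (A, B) \<Rightarrow> \<beta> (A, h -` B \<inter> space N)) = M.prob A"
    by (simp add: marginal_left)
qed (auto simp: measurable_sets[OF h] nonneg add_left marginal_right measure_distr M.prob_space_axioms)

end

section \<open>Kernels and disintegration\<close>

text \<open>Mixing over x the law of (x, y) with y drawn from \<open>\<Theta> x\<close> gives the
  measure. It serves twice: for comparison when a bimeasure is disintegrated, and to build the plan
  that belongs to a bimeasure.\<close>

lemma (in prob_space) kernel_product:
  assumes \<Theta>: "\<Theta> \<in> M \<rightarrow>\<^sub>M prob_algebra N"
  obtains \<gamma> where "prob_space \<gamma>" "sets \<gamma> = sets (M \<Otimes>\<^sub>M N)"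
    "\<And>A B. A \<in> sets M \<Longrightarrow> B \<in> sets N \<Longrightarrow>
       measure \<gamma> (A \<times> B) = (\<integral>x. measure (\<Theta> x) B * indicator A x \<partial>M)"
proof -
  define K where "K x = distr (\<Theta> x) (M \<Otimes>\<^sub>M N) (Pair x)" for x
  have sp: "\<Theta> x \<in> space (prob_algebra N)" if "x \<in> space M" for x
    using measurable_space[OF \<Theta> that] .
  then have sets_\<Theta>: "sets (\<Theta> x) = sets N" "prob_space (\<Theta> x)" if "x \<in> space M" for x
    using that by (auto simp: space_prob_algebra)
  have Pair: "Pair x \<in> \<Theta> x \<rightarrow>\<^sub>M M \<Otimes>\<^sub>M N" if "x \<in> space M" for x
    using that sets_\<Theta>(1)[OF that] by (simp add: measurable_Pair1' cong: measurable_cong_sets)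
  have K: "K \<in> M \<rightarrow>\<^sub>M prob_algebra (M \<Otimes>\<^sub>M N)"
  proof (rule measurable_prob_algebraI)
    show "prob_space (K x)" if "x \<in> space M" for x
      unfolding K_def using sets_\<Theta>(2) Pair that by (intro prob_space.prob_space_distr)
    show "K \<in> M \<rightarrow>\<^sub>M subprob_algebra (M \<Otimes>\<^sub>M N)"
      unfolding K_def by (rule measurable_distr2[where M=N]) (auto intro: measurable_prob_algebraD \<Theta>)
  qed
  have Msp: "M \<in> space (prob_algebra M)" by (simp add: space_prob_algebra prob_space_axioms)
  have em: "emeasure (M \<bind> K) (A \<times> B) = ennreal (\<integral>x. measure (\<Theta> x) B * indicator A x \<partial>M)"
    if [measurable]: "A \<in> sets M" "B \<in> sets N" for A B
  proof -
    have [measurable]: "(\<lambda>x. measure (\<Theta> x) B) \<in> borel_measurable M"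
      by (rule measurable_compose[OF measurable_prob_algebraD[OF \<Theta>]])
         (use that in \<open>simp add: measurable_measure_subprob_algebra\<close>)
    have "emeasure (M \<bind> K) (A \<times> B) = (\<integral>\<^sup>+x. emeasure (K x) (A \<times> B) \<partial>M)"
      by (rule emeasure_bind_prob_algebra[OF Msp K]) (use that in auto)
    also have "\<dots> = (\<integral>\<^sup>+x. ennreal (measure (\<Theta> x) B * indicator A x) \<partial>M)"
    proof (rule nn_integral_cong)
      fix x assume x: "x \<in> space M"
      interpret T: prob_space "\<Theta> x" by (rule sets_\<Theta>(2)[OF x])
      have "Pair x -` (A \<times> B) \<inter> space (\<Theta> x) = (if x \<in> A then B else {})"
        using sets.sets_into_space[OF that(2)] sets_eq_imp_space_eq[OF sets_\<Theta>(1)[OF x]] by auto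
      then show "emeasure (K x) (A \<times> B) = ennreal (measure (\<Theta> x) B * indicator A x)"
        using x that unfolding K_def by (subst emeasure_distr[OF Pair[OF x]]) (auto simp: T.emeasure_eq_measure)
    qed
    also have "\<dots> = ennreal (\<integral>x. measure (\<Theta> x) B * indicator A x \<partial>M)"
    proof (intro nn_integral_eq_integral integrable_const_bound[where B=1] AE_I2)
      fix x assume x: "x \<in> space M"
      interpret T: prob_space "\<Theta> x" by (rule sets_\<Theta>(2)[OF x])
      show "norm (measure (\<Theta> x) B * indicator A x) \<le> 1" by (auto simp: indicator_def)
    qed auto
    finally show ?thesis .
  qed
  show thesis
  proof
    show "prob_space (M \<bind> K)" using prob_space_bind'[OF Msp K] .
    show "sets (M \<bind> K) = sets (M \<Otimes>\<^sub>M N)" using sets_bind'[OF Msp K] .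
    show "measure (M \<bind> K) (A \<times> B) = (\<integral>x. measure (\<Theta> x) B * indicator A x \<partial>M)"
      if "A \<in> sets M" "B \<in> sets N" for A B
      using em[OF that] by (simp add: measure_def integral_nonneg)
  qed
qed

text \<open>The infimum is monotone and right-continuous in \<open>r\<close> whatever \<open>g\<close> is, so in the disintegration
  no exceptional null set of points has to be repaired.\<close>

lemma cdf_INF_rats:
  fixes g :: "rat \<Rightarrow> real"
  assumes g: "\<And>q. 0 \<le> g q" "\<And>q. q < 0 \<Longrightarrow> g q = 0" "\<And>q. 1 \<le> q \<Longrightarrow> g q = 1"
  defines "G \<equiv> \<lambda>r. INF q\<in>{q. r < of_rat q}. g q"
  shows "real_distribution (interval_measure G)" "cdf (interval_measure G) = G"
proof -
  have ne: "{q. r < of_rat q} \<noteq> {}" for r :: real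
    using of_rat_dense[of r "r + 1"] by auto
  have bdd: "bdd_below (g ` X)" for X using g(1) by (intro bdd_belowI[of _ 0]) auto
  have mono: "G r \<le> G s" if "r \<le> s" for r s
    unfolding G_def by (rule cINF_superset_mono[OF ne bdd]) (use that in auto)
  have low: "G r = 0" if "r < 0" for r
  proof -
    obtain q where q: "r < of_rat q" "of_rat q < (0::real)" using of_rat_dense[OF \<open>r < 0\<close>] by auto
    have "G r \<le> g q" unfolding G_def by (rule cINF_lower[OF bdd]) (use q in auto)
    moreover have "g q = 0" using q g by simp
    moreover have "0 \<le> G r" unfolding G_def by (rule cINF_greatest[OF ne]) (use g in auto)
    ultimately show ?thesis by simp
  qed
  have high: "G r = 1" if "1 \<le> r" for r
  proof -
    have "g q = 1" if "r < of_rat q" for q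
      using g(3)[of q] \<open>1 \<le> r\<close> that by (smt (verit) of_rat_1 of_rat_less_eq linear order.trans of_rat_less)
    then have "g ` {q. r < of_rat q} = {1}" using ne[of r] by force
    then show ?thesis by (simp add: G_def)
  qed
  have rc: "continuous (at_right a) G" for a
    unfolding continuous_within
  proof (rule order_tendstoI)
    fix y assume "y < G a"
    then show "\<forall>\<^sub>F x in at_right a. y < G x"
      using mono by (intro eventually_at_rightI[of a "a+1"]) (auto intro: less_le_trans less_imp_le)
  next
    fix y assume "G a < y"
    then obtain q where q: "a < of_rat q" "g q < y"
      unfolding G_def cINF_less_iff[OF ne bdd] by auto
    have "G x < y" if "x < of_rat q" for x
    proof -
      have "G x \<le> g q" unfolding G_def by (rule cINF_lower[OF bdd]) (use that in auto)
      then show ?thesis using q by simp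
    qed
    then show "\<forall>\<^sub>F x in at_right a. G x < y"
      using q by (intro eventually_at_rightI[of a "of_rat q"]) auto
  qed
  have bot: "(G \<longlongrightarrow> 0) at_bot"
    by (rule tendsto_eventually) (use low in \<open>auto simp: eventually_at_bot_dense\<close>)
  have top: "(G \<longlongrightarrow> 1) at_top"
    by (rule tendsto_eventually) (use high in \<open>auto simp: eventually_at_top_linorder\<close>)
  show "real_distribution (interval_measure G)"
    by (rule real_distribution_interval_measure[OF mono rc bot top])
  show "cdf (interval_measure G) = G"
    by (rule cdf_interval_measure[OF mono rc bot])
qed

text \<open>The kernel is assembled from distribution functions whose raw material is the densities
  of A -> \<open>\<beta> (A, {..q})\<close> for rational q; countably many thresholds keep the
  almost sure comparisons simultaneous. Concentration of N on [0,1) settles the behaviour at both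
  ends.\<close>

lemma bimeasure_kernel_real:
  assumes \<beta>: "bimeasure M N \<beta>" and N: "sets N = sets (borel :: real measure)"
    and N01: "AE r in N. 0 \<le> r \<and> r < 1"
  obtains \<Theta> where "\<Theta> \<in> M \<rightarrow>\<^sub>M prob_algebra borel"
    "\<And>A B. A \<in> sets M \<Longrightarrow> B \<in> sets borel \<Longrightarrow> \<beta> (A, B) = (\<integral>x. measure (\<Theta> x) B * indicator A x \<partial>M)"
proof -
  interpret bimeasure M N \<beta> by (rule \<beta>)
  have sN: "space N = UNIV" using sets_eq_imp_space_eq[OF N] by simp
  have zero: "\<beta> (A, B) = 0" if "A \<in> sets M" "B \<in> sets borel" "B \<inter> {0..<1} = {}" for A B
  proof -
    have "AE r in N. r \<notin> B"
      using N01 by eventually_elim (use that(3) in auto)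
    then have "measure N B = 0"
      using that N by (intro measure_eq_0_null_sets) (simp add: AE_iff_null_sets)
    then show ?thesis using le_right[of A B] nonneg[of A B] that N by simp
  qed
  have "\<exists>g. g \<in> borel_measurable M \<and> (\<forall>x. 0 \<le> g x \<and> g x \<le> 1) \<and>
     (\<forall>A\<in>sets M. \<beta> (A, {..of_rat q}) = (\<integral>x. g x * indicator A x \<partial>M))" for q
    using left_density[of "{..of_rat q}"] N by (metis borel_closed closed_atMost)
  then obtain g0 where g0: "\<And>q. g0 q \<in> borel_measurable M" "\<And>q x. 0 \<le> g0 q x" "\<And>q x. g0 q x \<le> 1"
    "\<And>q A. A \<in> sets M \<Longrightarrow> \<beta> (A, {..of_rat q}) = (\<integral>x. g0 q x * indicator A x \<partial>M)"
    by metis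
  \<comment> \<open>For q outside [0,1) the density is almost surely 0 or 1. Overwriting it there
    preserves all integrals and supplies the hypotheses of \<open>cdf_INF_rats\<close> at every
    x.\<close>
  define g where "g q x = (if q < 0 then 0 else if 1 \<le> q then 1 else g0 q x)" for q x
  have g [measurable]: "g q \<in> borel_measurable M" for q unfolding g_def using g0(1) by simp
  have g01: "0 \<le> g q x" "g q x \<le> 1" for q x by (auto simp: g_def g0)
  have g_int: "\<beta> (A, {..of_rat q}) = (\<integral>x. g q x * indicator A x \<partial>M)" if A: "A \<in> sets M" for q A
  proof -
    have disj: "r < 0 \<Longrightarrow> {..r} \<inter> {0..<1} = {}" "1 \<le> r \<Longrightarrow> {r<..} \<inter> {0..<1} = {}" for r :: real
      by auto
    consider "q < 0" | "1 \<le> q" | "0 \<le> q" "q < 1" by linarith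
    then show ?thesis
    proof cases
      case 1
      then have "of_rat q < (0::real)" by simp
      then show ?thesis using 1 zero[OF A _ disj(1)] by (simp add: g_def)
    next
      case 2
      then have "1 \<le> (of_rat q :: real)" by simp
      then have "\<beta> (A, {of_rat q<..}) = 0" by (intro zero A disj) auto
      moreover have "{..of_rat q} \<union> {of_rat q<..} = (UNIV :: real set)" by auto
      ultimately have "\<beta> (A, {..of_rat q}) = measure M A"
        using add_right[OF A, of "{..of_rat q}" "{of_rat q<..}"] marginal_left[OF A] N sN by (auto simp: Int_def)
      then show ?thesis using 2 A by (simp add: g_def)
    next
      case 3 then show ?thesis using g0(4)[OF A] by (simp add: g_def)
    qed
  qed
  define G where "G x r = (INF q\<in>{q. r < of_rat q}. g q x)" for x and r :: real
  define \<Theta> where "\<Theta> x = interval_measure (G x)" for x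
  have \<Theta>: "real_distribution (\<Theta> x)" "cdf (\<Theta> x) = G x" for x
  proof -
    have Gx: "G x = (\<lambda>r. INF q\<in>{q. r < of_rat q}. g q x)" by (simp add: G_def fun_eq_iff)
    have low: "g q x = 0" if "q < 0" for q using that by (simp add: g_def)
    have high: "g q x = 1" if "1 \<le> q" for q using that by (simp add: g_def)
    show "real_distribution (\<Theta> x)"
      unfolding \<Theta>_def Gx by (rule cdf_INF_rats(1)[of "\<lambda>q. g q x", OF g01(1) low high])
    show "cdf (\<Theta> x) = G x"
      unfolding \<Theta>_def Gx by (rule cdf_INF_rats(2)[of "\<lambda>q. g q x", OF g01(1) low high])
  qed
  have ne: "{q. r < of_rat q} \<noteq> {}" for r :: real
    using of_rat_dense[of r "r + 1"] by auto
  have bdd: "bdd_below ((\<lambda>q. g q x) ` X)" for X x using g01(1) by (intro bdd_belowI[of _ 0]) auto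
  have [measurable]: "(\<lambda>x. G x r) \<in> borel_measurable M" for r
    unfolding G_def by (rule borel_measurable_cINF) (auto intro: bdd)
  have G01: "0 \<le> G x r" "G x r \<le> 1" for x r
    using real_distribution.cdf_bounded_prob[OF \<Theta>(1)[of x], of r]
      finite_borel_measure.cdf_nonneg[OF real_distribution.finite_borel_measure_M[OF \<Theta>(1)[of x]], of r]
    by (simp_all add: \<Theta>(2))
  have sets_\<Theta>: "sets (\<Theta> x) = sets borel" for x
    by (simp add: \<Theta>_def)
  have prob_\<Theta>: "prob_space (\<Theta> x)" for x using \<Theta>(1)[of x] by (simp add: real_distribution_def)
  have \<Theta>_meas: "\<Theta> \<in> M \<rightarrow>\<^sub>M prob_algebra borel"
  proof (rule measurable_prob_algebra_generated[where \<Omega>=UNIV and G="range atMost"])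
    show "sets (borel :: real measure) = sigma_sets UNIV (range atMost)"
      by (subst borel_eq_atMost) (simp add: image_def)
    show "Int_stable (range (atMost :: real \<Rightarrow> _))"
      by (auto simp: Int_stable_def)
    fix A :: "real set" assume "A \<in> range atMost"
    then obtain r where "A = {..r}" by auto
    moreover have "emeasure (\<Theta> x) {..r} = ennreal (G x r)" for x
      using finite_measure.emeasure_eq_measure[of "\<Theta> x"] prob_\<Theta>[of x] \<Theta>(2)[of x]
      by (simp add: cdf_def prob_space_def fun_eq_iff)
    ultimately show "(\<lambda>x. emeasure (\<Theta> x) A) \<in> borel_measurable M" by simp
  qed (auto simp: sets_\<Theta> prob_\<Theta>)
  have intb: "integrable M f" if "f \<in> borel_measurable M" "\<And>x. 0 \<le> f x" "\<And>x. f x \<le> 1" for f :: "_ \<Rightarrow> real"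
    using that by (intro M.integrable_const_bound[where B=1]) auto
  have G_int: "\<beta> (A, {..r}) = (\<integral>x. G x r * indicator A x \<partial>M)" if A [measurable]: "A \<in> sets M" for A r
  proof -
    obtain L where L: "finite_measure L" "sets L = sets N" "\<And>B. B \<in> sets N \<Longrightarrow> measure L B = \<beta> (A, B)"
      using right_measure[OF A] by blast
    interpret L: finite_borel_measure L
      using L N by (simp add: finite_borel_measure_def finite_borel_measure_axioms_def)
    have cdfL: "cdf L s = \<beta> (A, {..s})" for s using L(3) N by (simp add: cdf_def)
    show ?thesis
    proof (rule antisym)
      obtain h where h [measurable]: "h \<in> borel_measurable M" and h01: "\<And>x. 0 \<le> h x" "\<And>x. h x \<le> 1"
        and hint: "\<And>A. A \<in> sets M \<Longrightarrow> \<beta> (A, {..r}) = (\<integral>x. h x * indicator A x \<partial>M)"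
        using left_density[of "{..r}"] N by auto
      \<comment> \<open>The density h of \<open>{..r}\<close> is almost surely below
        \<open>g q\<close> for each of the countably many rational q > r, hence below their
        infimum.\<close>
      have "AE x in M. \<forall>q\<in>{q. r < of_rat q}. h x \<le> g q x"
      proof (subst AE_ball_countable)
        show "\<forall>q\<in>{q. r < of_rat q}. AE x in M. h x \<le> g q x"
        proof safe
          fix q :: rat assume q: "r < of_rat q"
          show "AE x in M. h x \<le> g q x"
          proof (rule AE_leI_integral)
            fix A assume A: "A \<in> sets M"
            show "(\<integral>x. h x * indicator A x \<partial>M) \<le> (\<integral>x. g q x * indicator A x \<partial>M)"
              using mono_right[OF A, of "{..r}" "{..of_rat q}"] q N
              by (simp add: hint[OF A, symmetric] g_int[OF A, symmetric])
          qed (use h h01 g g01 in \<open>auto intro!: intb\<close>)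
        qed
      qed auto
      then have "AE x in M. h x \<le> G x r"
        by eventually_elim (auto simp: G_def intro!: cINF_greatest ne)
      then have "(\<integral>x. h x * indicator A x \<partial>M) \<le> (\<integral>x. G x r * indicator A x \<partial>M)"
        by (intro integral_mono_AE intb) (auto simp: indicator_def h01 G01 elim: eventually_mono)
      then show "\<beta> (A, {..r}) \<le> (\<integral>x. G x r * indicator A x \<partial>M)" using hint[OF A] by simp
    next
      have le: "(\<integral>x. G x r * indicator A x \<partial>M) \<le> cdf L (of_rat q)" if "r < of_rat q" for q
      proof -
        have "G x r \<le> g q x" for x unfolding G_def by (rule cINF_lower[OF bdd]) (use that in auto)
        then have "(\<integral>x. G x r * indicator A x \<partial>M) \<le> (\<integral>x. g q x * indicator A x \<partial>M)"
          by (intro integral_mono intb) (auto simp: indicator_def g01 G01)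
        then show ?thesis using g_int[OF A] cdfL by simp
      qed
      have "(\<integral>x. G x r * indicator A x \<partial>M) \<le> cdf L s" if "r < s" for s
        using of_rat_dense[OF \<open>r < s\<close>] le L.cdf_nondecreasing by (meson less_imp_le order_trans)
      \<comment> \<open>The bound is known only for s > r. Right-continuity holds because L is a
        genuine measure; it closes the gap at r.\<close>
      moreover have "(cdf L \<longlongrightarrow> cdf L r) (at_right r)"
        using L.cdf_is_right_cont by (simp add: continuous_within)
      ultimately have "(\<integral>x. G x r * indicator A x \<partial>M) \<le> cdf L r"
        by (intro tendsto_lowerbound[of "cdf L" _ "at_right r"])
           (auto intro!: eventually_at_rightI[of r "r+1"] simp: trivial_limit_at_right_real)
      then show "(\<integral>x. G x r * indicator A x \<partial>M) \<le> \<beta> (A, {..r})" using cdfL by simp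
    qed
  qed
  obtain \<gamma> where \<gamma>: "prob_space \<gamma>" "sets \<gamma> = sets (M \<Otimes>\<^sub>M borel)"
    "\<And>A B. A \<in> sets M \<Longrightarrow> B \<in> sets borel \<Longrightarrow>
       measure \<gamma> (A \<times> B) = (\<integral>x. measure (\<Theta> x) B * indicator A x \<partial>M)"
    using M.kernel_product[OF \<Theta>_meas] by blast
  interpret \<gamma>: prob_space \<gamma> by fact
  have "\<beta> (A, B) = measure \<gamma> (A \<times> B)" if A [measurable]: "A \<in> sets M" and B: "B \<in> sets borel" for A B
  proof -
    have [measurable_cong]: "sets \<gamma> = sets (M \<Otimes>\<^sub>M borel)" by fact
    obtain L where L: "finite_measure L" "sets L = sets N" "\<And>B. B \<in> sets N \<Longrightarrow> measure L B = \<beta> (A, B)"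
      using right_measure[OF A] by blast
    \<comment> \<open>K is B -> \<open>measure \<gamma> (A \<times> B)\<close>, written as an image
      measure so that countable additivity comes for free. It has the same distribution function as
      L, which extends the identity from half-lines to all Borel sets.\<close>
    define K where "K = distr (density \<gamma> (indicator (A \<times> UNIV))) borel snd"
    have AU [measurable]: "A \<times> UNIV \<in> sets (M \<Otimes>\<^sub>M (borel :: real measure))"
      by (intro pair_measureI) auto
    have emK: "emeasure K B = ennreal (measure \<gamma> (A \<times> B))" if [measurable]: "B \<in> sets borel" for B
    proof -
      have "snd -` B \<inter> space \<gamma> \<in> sets \<gamma>" by (rule measurable_sets[OF _ that]) measurable
      then have "emeasure K B = (\<integral>\<^sup>+z. indicator (A \<times> UNIV) z * indicator (snd -` B \<inter> space \<gamma>) z \<partial>\<gamma>)"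
        unfolding K_def by (subst emeasure_distr) (auto intro!: emeasure_density)
      also have "\<dots> = (\<integral>\<^sup>+z. indicator (A \<times> B) z \<partial>\<gamma>)"
        by (intro nn_integral_cong) (auto simp: indicator_def)
      also have "\<dots> = emeasure \<gamma> (A \<times> B)" by (rule nn_integral_indicator) (auto simp: \<gamma>(2))
      finally show ?thesis by (simp add: \<gamma>.emeasure_eq_measure)
    qed
    have "L = K"
    proof (rule cdf_unique')
      show "finite_borel_measure L"
        using L N by (simp add: finite_borel_measure_def finite_borel_measure_axioms_def)
      have "space K = UNIV" by (simp add: K_def)
      then have "finite_measure K" by (intro finite_measureI) (simp add: emK)
      then show "finite_borel_measure K"
        by (simp add: finite_borel_measure_def finite_borel_measure_axioms_def K_def)
      show "cdf L = cdf K"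
      proof
        fix r
        have "cdf L r = (\<integral>x. cdf (\<Theta> x) r * indicator A x \<partial>M)"
          using L(3) N G_int[OF A] by (simp add: cdf_def \<Theta>(2)[unfolded cdf_def])
        also have "\<dots> = cdf K r"
          using emK[of "{..r}"] \<gamma>(3)[OF A, of "{..r}"] by (simp add: cdf_def measure_def)
        finally show "cdf L r = cdf K r" .
      qed
    qed
    then show ?thesis using L(3)[of B] N B emK[OF B] by (simp add: measure_def)
  qed
  then show thesis using that[OF \<Theta>_meas] \<gamma>(3) by simp
qed

text \<open>The bimeasure is moved to the real line by \<open>\<phi>\<close>, disintegrated there,
  and the kernel is pushed back by \<open>\<psi>\<close>. Since
  \<open>\<psi> (\<phi> y) = y\<close>, pulling B back along \<open>\<psi>\<close> and then along
  \<open>\<phi>\<close> returns B.\<close>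

theorem bimeasure_kernel:
  fixes N :: "'b::polish_space measure"
  assumes \<beta>: "bimeasure M N \<beta>" and N: "sets N = sets borel"
  obtains \<Theta> where "\<Theta> \<in> M \<rightarrow>\<^sub>M prob_algebra borel"
    "\<And>A B. A \<in> sets M \<Longrightarrow> B \<in> sets borel \<Longrightarrow> \<beta> (A, B) = (\<integral>x. measure (\<Theta> x) B * indicator A x \<partial>M)"
proof -
  interpret bimeasure M N \<beta> by (rule \<beta>)
  have sN: "space N = UNIV" using sets_eq_imp_space_eq[OF N] by simp
  obtain \<phi> :: "'b \<Rightarrow> real" and \<psi> :: "real \<Rightarrow> 'b" where \<phi>: "\<phi> \<in> borel_measurable borel"
    and \<psi> [measurable]: "\<psi> \<in> borel_measurable borel" and \<psi>\<phi>: "\<And>y. \<psi> (\<phi> y) = y"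
    and \<phi>01: "\<And>y. 0 \<le> \<phi> y \<and> \<phi> y < 1"
    using polish_retract_of_real by blast
  have [measurable]: "\<phi> \<in> borel_measurable N" using \<phi> N by (simp cong: measurable_cong_sets)
  obtain \<Theta> where \<Theta>: "\<Theta> \<in> M \<rightarrow>\<^sub>M prob_algebra borel"
    and eq: "\<And>A B. A \<in> sets M \<Longrightarrow> B \<in> sets borel \<Longrightarrow>
      (case (A, B) of (A, B) \<Rightarrow> \<beta> (A, \<phi> -` B \<inter> space N)) = (\<integral>x. measure (\<Theta> x) B * indicator A x \<partial>M)"
    by (rule bimeasure_kernel_real[OF bimeasure_image[of \<phi> borel]])
       (use \<phi>01 in \<open>auto simp: AE_distr_iff\<close>)
  have sp: "\<Theta> x \<in> space (prob_algebra borel)" if "x \<in> space M" for x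
    using measurable_space[OF \<Theta> that] .
  show thesis
  proof
    show "(\<lambda>x. distr (\<Theta> x) borel \<psi>) \<in> M \<rightarrow>\<^sub>M prob_algebra borel"
      by (rule measurable_compose[OF \<Theta> measurable_distr_prob_space[OF \<psi>]])
    fix A and B :: "'b set" assume A: "A \<in> sets M" and [measurable]: "B \<in> sets borel"
    have "\<psi> -` B \<inter> space borel \<in> sets borel" by measurable
    then have "\<psi> -` B \<in> sets borel" by simp
    then have "\<beta> (A, B) = (\<integral>x. measure (\<Theta> x) (\<psi> -` B) * indicator A x \<partial>M)"
      using eq[OF A, of "\<psi> -` B"] sN by (simp add: vimage_comp comp_def \<psi>\<phi>)
    also have "\<dots> = (\<integral>x. measure (distr (\<Theta> x) borel \<psi>) B * indicator A x \<partial>M)"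
    proof (intro Bochner_Integration.integral_cong refl)
      fix x assume "x \<in> space M"
      then have s: "sets (\<Theta> x) = sets borel" using sp by (auto simp: space_prob_algebra)
      then have "\<psi> \<in> borel_measurable (\<Theta> x)" by (simp cong: measurable_cong_sets)
      then show "measure (\<Theta> x) (\<psi> -` B) * indicator A x = measure (distr (\<Theta> x) borel \<psi>) B * indicator A x"
        using sets_eq_imp_space_eq[OF s] by (simp add: measure_distr)
    qed
    finally show "\<beta> (A, B) = (\<integral>x. measure (distr (\<Theta> x) borel \<psi>) B * indicator A x \<partial>M)" .
  qed
qed

section \<open>Transference plans\<close>

lemma borel_rect:
  fixes A :: "'a::second_countable_topology set" and B :: "'b::second_countable_topology set"
  assumes "A \<in> sets borel" "B \<in> sets borel" shows "A \<times> B \<in> sets borel"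
  unfolding borel_prod[symmetric] using assms by (rule pair_measureI)

lemma sets_borel_pair:
  "sets (borel \<Otimes>\<^sub>M borel) = sets (borel :: ('a::second_countable_topology \<times> 'b::second_countable_topology) measure)"
  by (subst borel_prod) (rule refl)

locale marginals =
  fixes \<eta> :: "'e::polish_space measure" and \<nu> :: "'s::polish_space measure"
  assumes \<eta>: "\<eta> \<in> borel_probs" and \<nu>: "\<nu> \<in> borel_probs"
begin

sublocale \<eta>: prob_space \<eta> using \<eta> by (simp add: borel_probs_iff)
sublocale \<nu>: prob_space \<nu> using \<nu> by (simp add: borel_probs_iff)

lemma sets_\<eta> [simp, measurable_cong]: "sets \<eta> = sets borel" using \<eta> by (simp add: borel_probs_iff)
lemma sets_\<nu> [simp, measurable_cong]: "sets \<nu> = sets borel" using \<nu> by (simp add: borel_probs_iff)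
lemma space_\<eta> [simp]: "space \<eta> = UNIV" using sets_eq_imp_space_eq[OF sets_\<eta>] by simp
lemma space_\<nu> [simp]: "space \<nu> = UNIV" using sets_eq_imp_space_eq[OF sets_\<nu>] by simp

lemma plan_iff:
  "\<gamma> \<in> transference_plans \<eta> \<nu> \<longleftrightarrow> sets \<gamma> = sets borel \<and> prob_space \<gamma> \<and>
     (\<forall>A\<in>sets borel. measure \<gamma> (A \<times> UNIV) = measure \<eta> A) \<and>
     (\<forall>B\<in>sets borel. measure \<gamma> (UNIV \<times> B) = measure \<nu> B)"
proof (cases "sets \<gamma> = sets borel \<and> prob_space \<gamma>")
  case True
  then interpret \<gamma>: prob_space \<gamma> by simp
  have [measurable_cong]: "sets \<gamma> = sets (borel \<Otimes>\<^sub>M borel)" using True by (simp only: sets_borel_pair)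
  have [measurable]: "fst \<in> borel_measurable \<gamma>" "snd \<in> borel_measurable \<gamma>"
    by measurable
  have [simp]: "space \<gamma> = UNIV" using sets_eq_imp_space_eq[of \<gamma> borel] True by simp
  have d: "measure (distr \<gamma> borel fst) A = measure \<gamma> (A \<times> UNIV)" if "A \<in> sets borel" for A
    using that by (subst measure_distr) (auto simp: fst_vimage_eq_Times[symmetric] intro!: arg_cong[where f="measure \<gamma>"])
  have d': "measure (distr \<gamma> borel snd) B = measure \<gamma> (UNIV \<times> B)" if "B \<in> sets borel" for B
    using that by (subst measure_distr) (auto intro!: arg_cong[where f="measure \<gamma>"])
  interpret d: prob_space "distr \<gamma> borel fst" by (rule \<gamma>.prob_space_distr) simp
  interpret d': prob_space "distr \<gamma> borel snd" by (rule \<gamma>.prob_space_distr) simp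
  have "distr \<gamma> borel fst = \<eta> \<longleftrightarrow> (\<forall>A\<in>sets borel. measure \<gamma> (A \<times> UNIV) = measure \<eta> A)"
    using d by (auto intro!: measure_eqI simp: d.emeasure_eq_measure \<eta>.emeasure_eq_measure)
  moreover have "distr \<gamma> borel snd = \<nu> \<longleftrightarrow> (\<forall>B\<in>sets borel. measure \<gamma> (UNIV \<times> B) = measure \<nu> B)"
    using d' by (auto intro!: measure_eqI simp: d'.emeasure_eq_measure \<nu>.emeasure_eq_measure)
  ultimately show ?thesis using True by (simp add: transference_plans_def borel_probs_iff)
qed (auto simp: transference_plans_def borel_probs_iff)

lemma plan_bimeasure:
  assumes "\<gamma> \<in> transference_plans \<eta> \<nu>"
  shows "bimeasure \<eta> \<nu> (\<lambda>(A, B). measure \<gamma> (A \<times> B))"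
proof -
  have \<gamma>: "sets \<gamma> = sets borel" and p: "prob_space \<gamma>" using assms by (auto simp: plan_iff)
  interpret \<gamma>: prob_space \<gamma> by (rule p)
  have "measure \<gamma> ((A \<union> A') \<times> B) = measure \<gamma> (A \<times> B) + measure \<gamma> (A' \<times> B)"
    if "A \<in> sets borel" "A' \<in> sets borel" "B \<in> sets borel" "A \<inter> A' = {}" for A A' B
    unfolding Sigma_Un_distrib1 using that by (intro \<gamma>.finite_measure_Union) (auto simp: \<gamma> borel_rect)
  moreover have "measure \<gamma> (A \<times> (B \<union> B')) = measure \<gamma> (A \<times> B) + measure \<gamma> (A \<times> B')"
    if "A \<in> sets borel" "B \<in> sets borel" "B' \<in> sets borel" "B \<inter> B' = {}" for A B B'
    unfolding Sigma_Un_distrib2 using that by (intro \<gamma>.finite_measure_Union) (auto simp: \<gamma> borel_rect)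
  ultimately show ?thesis using assms
    by (intro bimeasure.intro bimeasure_axioms.intro)
       (auto simp: plan_iff \<eta>.prob_space_axioms \<nu>.prob_space_axioms)
qed

text \<open>Additivity in each variable need not extend from rectangles to a measure on the product.
  The kernel of \<open>\<beta>\<close>, integrated back against \<open>\<eta>\<close>, provides the
  extension.\<close>

lemma bimeasure_plan:
  assumes \<beta>: "bimeasure \<eta> \<nu> \<beta>"
  obtains \<gamma> where "\<gamma> \<in> transference_plans \<eta> \<nu>"
    "\<And>A B. A \<in> sets borel \<Longrightarrow> B \<in> sets borel \<Longrightarrow> measure \<gamma> (A \<times> B) = \<beta> (A, B)"
proof -
  interpret bimeasure \<eta> \<nu> \<beta> by (rule \<beta>)
  obtain \<Theta> where \<Theta>: "\<Theta> \<in> \<eta> \<rightarrow>\<^sub>M prob_algebra borel"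
    "\<And>A B. A \<in> sets \<eta> \<Longrightarrow> B \<in> sets borel \<Longrightarrow> \<beta> (A, B) = (\<integral>x. measure (\<Theta> x) B * indicator A x \<partial>\<eta>)"
    using bimeasure_kernel[OF \<beta> sets_\<nu>] by blast
  obtain \<gamma> where \<gamma>: "prob_space \<gamma>" "sets \<gamma> = sets (\<eta> \<Otimes>\<^sub>M borel)"
    "\<And>A B. A \<in> sets \<eta> \<Longrightarrow> B \<in> sets borel \<Longrightarrow>
       measure \<gamma> (A \<times> B) = (\<integral>x. measure (\<Theta> x) B * indicator A x \<partial>\<eta>)"
    using \<eta>.kernel_product[OF \<Theta>(1)] by blast
  have "sets (\<eta> \<Otimes>\<^sub>M (borel :: 's measure)) = sets (borel \<Otimes>\<^sub>M borel)"
    by (rule sets_pair_measure_cong) auto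
  then have "sets \<gamma> = sets borel" using \<gamma>(2) by (simp only: sets_borel_pair)
  then show thesis using that[of \<gamma>] \<gamma> \<Theta>(2) marginal_left marginal_right
    by (simp add: plan_iff)
qed

lemma plan_eqI:
  assumes "\<gamma> \<in> transference_plans \<eta> \<nu>" "\<gamma>' \<in> transference_plans \<eta> \<nu>"
    and eq: "\<And>A B. A \<in> sets borel \<Longrightarrow> B \<in> sets borel \<Longrightarrow> measure \<gamma> (A \<times> B) = measure \<gamma>' (A \<times> B)"
  shows "\<gamma> = \<gamma>'"
proof -
  have *: "sets \<gamma> = sets borel" "prob_space \<gamma>" "sets \<gamma>' = sets borel" "prob_space \<gamma>'"
    using assms by (auto simp: plan_iff)
  interpret \<gamma>: prob_space \<gamma> by fact
  interpret \<gamma>': prob_space \<gamma>' by fact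
  have b: "sets (borel :: ('e \<times> 's) measure) =
      sigma_sets UNIV {a \<times> b | a b. a \<in> sets borel \<and> b \<in> sets borel}"
    unfolding borel_prod[symmetric] sets_pair_measure by simp
  show ?thesis
  proof (rule measure_eqI_generator_eq[where \<Omega>=UNIV])
    show "Int_stable {a \<times> b | a b. a \<in> sets (borel :: 'e measure) \<and> b \<in> sets (borel :: 's measure)}"
      using Int_stable_pair_measure_generator[of borel borel] by simp
    show "range (\<lambda>_::nat. UNIV \<times> UNIV) \<subseteq> {a \<times> b | a b. a \<in> sets (borel :: 'e measure) \<and> b \<in> sets (borel :: 's measure)}"
      by (auto intro!: exI[of _ UNIV])
    fix X assume "X \<in> {a \<times> b | a b. a \<in> sets (borel :: 'e measure) \<and> b \<in> sets (borel :: 's measure)}"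
    then obtain a b where "X = a \<times> b" "a \<in> sets borel" "b \<in> sets borel" by blast
    then show "emeasure \<gamma> X = emeasure \<gamma>' X"
      by (simp add: eq \<gamma>.emeasure_eq_measure \<gamma>'.emeasure_eq_measure)
  qed (auto simp: * b)
qed

lemma ex_kernel:
  assumes \<gamma>: "\<gamma> \<in> transference_plans \<eta> \<nu>"
  shows "\<exists>\<Theta>. is_kernel \<eta> \<gamma> \<Theta>"
proof -
  obtain \<Theta> where \<Theta>: "\<Theta> \<in> \<eta> \<rightarrow>\<^sub>M prob_algebra borel"
    "\<And>A B. A \<in> sets \<eta> \<Longrightarrow> B \<in> sets borel \<Longrightarrow>
      (case (A, B) of (A, B) \<Rightarrow> measure \<gamma> (A \<times> B)) = (\<integral>x. measure (\<Theta> x) B * indicator A x \<partial>\<eta>)"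
    using bimeasure_kernel[OF plan_bimeasure[OF \<gamma>] sets_\<nu>] by blast
  have "(\<lambda>x. measure (\<Theta> x) B) \<in> borel_measurable borel" if "B \<in> sets borel" for B
  proof -
    have "(\<lambda>x. measure (\<Theta> x) B) \<in> borel_measurable \<eta>"
      by (rule measurable_compose[OF measurable_prob_algebraD[OF \<Theta>(1)]])
         (use that in \<open>simp add: measurable_measure_subprob_algebra\<close>)
    then show ?thesis by (simp cong: measurable_cong_sets)
  qed
  moreover have "\<Theta> x \<in> borel_probs" for x using measurable_space[OF \<Theta>(1), of x] by simp
  ultimately show ?thesis using \<Theta>(2)
    by (intro exI[of _ \<Theta>]) (simp add: is_kernel_def set_lebesgue_integral_def mult.commute)
qed

lemma kernel_of:
  assumes \<gamma>: "\<gamma> \<in> transference_plans \<eta> \<nu>" and C: "C \<in> sets borel"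
  shows "(\<lambda>x. measure (kernel_of \<eta> \<gamma> x) C) \<in> borel_measurable borel"
    and "0 \<le> measure (kernel_of \<eta> \<gamma> x) C" "measure (kernel_of \<eta> \<gamma> x) C \<le> 1"
    and "A \<in> sets borel \<Longrightarrow>
      measure \<gamma> (A \<times> C) = (\<integral>x. measure (kernel_of \<eta> \<gamma> x) C * indicator A x \<partial>\<eta>)"
proof -
  have k: "is_kernel \<eta> \<gamma> (kernel_of \<eta> \<gamma>)"
    unfolding kernel_of_def using ex_kernel[OF \<gamma>] by (rule someI_ex)
  then show "(\<lambda>x. measure (kernel_of \<eta> \<gamma> x) C) \<in> borel_measurable borel"
    "A \<in> sets borel \<Longrightarrow>
      measure \<gamma> (A \<times> C) = (\<integral>x. measure (kernel_of \<eta> \<gamma> x) C * indicator A x \<partial>\<eta>)"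
    using C by (auto simp: is_kernel_def set_lebesgue_integral_def mult.commute)
  have "prob_space (kernel_of \<eta> \<gamma> x)" using k by (auto simp: is_kernel_def borel_probs_iff)
  then show "0 \<le> measure (kernel_of \<eta> \<gamma> x) C" "measure (kernel_of \<eta> \<gamma> x) C \<le> 1"
    by (auto simp: prob_space.prob_le_1)
qed

lemma plan_integral:
  assumes \<gamma>: "\<gamma> \<in> transference_plans \<eta> \<nu>" and C [measurable]: "C \<in> sets borel"
    and f [measurable]: "f \<in> borel_measurable borel" and f01: "\<And>x. 0 \<le> f x" "\<And>x. f x \<le> 1"
    and fint: "\<And>A. A \<in> sets borel \<Longrightarrow> measure \<gamma> (A \<times> C) = (\<integral>x. f x * indicator A x \<partial>\<eta>)"
    and h [measurable]: "h \<in> borel_measurable borel"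
  shows "(\<integral>z. h (fst z) * indicator C (snd z) \<partial>\<gamma>) = (\<integral>x. h x * f x \<partial>\<eta> :: real)"
proof -
  have s\<gamma>: "sets \<gamma> = sets borel" and p: "prob_space \<gamma>" using \<gamma> by (auto simp: plan_iff)
  interpret \<gamma>: prob_space \<gamma> by (rule p)
  have [measurable_cong]: "sets \<gamma> = sets (borel \<Otimes>\<^sub>M borel)" using s\<gamma> by (simp only: sets_borel_pair)
  have [simp]: "space \<gamma> = UNIV" using sets_eq_imp_space_eq[OF s\<gamma>] by simp
  define K where "K = distr (density \<gamma> (\<lambda>z. ennreal (indicator C (snd z)))) borel fst"
  have "K = density \<eta> (\<lambda>x. ennreal (f x))"
  proof (rule measure_eqI)
    fix A assume "A \<in> sets K"
    then have A [measurable]: "A \<in> sets borel" by (simp add: K_def)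
    have "fst -` A \<inter> space \<gamma> \<in> sets \<gamma>" by measurable
    then have [measurable]: "fst -` A \<in> sets \<gamma>" by simp
    have "emeasure K A = (\<integral>\<^sup>+z. ennreal (indicator C (snd z)) * indicator (fst -` A) z \<partial>\<gamma>)"
      unfolding K_def
      by (subst emeasure_distr) (auto intro!: emeasure_density)
    also have "\<dots> = (\<integral>\<^sup>+z. indicator (A \<times> C) z \<partial>\<gamma>)"
      by (intro nn_integral_cong) (auto simp: indicator_def)
    also have "\<dots> = emeasure \<gamma> (A \<times> C)" by (rule nn_integral_indicator) (auto simp: s\<gamma> borel_rect)
    also have "\<dots> = ennreal (\<integral>x. f x * indicator A x \<partial>\<eta>)"
      using fint[OF A] by (simp add: \<gamma>.emeasure_eq_measure)
    also have "\<dots> = (\<integral>\<^sup>+x. ennreal (f x * indicator A x) \<partial>\<eta>)"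
      by (subst nn_integral_eq_integral)
         (auto intro!: \<eta>.integrable_const_bound[where B=1] AE_I2 simp: indicator_def f01)
    also have "\<dots> = emeasure (density \<eta> (\<lambda>x. ennreal (f x))) A"
      by (subst emeasure_density) (auto intro!: nn_integral_cong simp: indicator_def)
    finally show "emeasure K A = emeasure (density \<eta> (\<lambda>x. ennreal (f x))) A" .
  qed (simp add: K_def)
  moreover have "(\<integral>x. h x \<partial>density \<eta> (\<lambda>x. ennreal (f x))) = (\<integral>x. f x *\<^sub>R h x \<partial>\<eta>)"
    by (rule integral_density) (auto simp: f01)
  moreover have "(\<integral>x. h x \<partial>K) = (\<integral>z. indicator C (snd z) *\<^sub>R h (fst z) \<partial>\<gamma>)"
    unfolding K_def by (subst integral_distr; (subst integral_density)?) auto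
  ultimately show ?thesis by (simp add: mult.commute)
qed

end

section \<open>Compactness of sets of plans\<close>

primrec rect_max :: "(nat \<Rightarrow> real) \<Rightarrow> (nat \<Rightarrow> 'a set) \<Rightarrow> (nat \<Rightarrow> 'b set) \<Rightarrow> nat \<Rightarrow> 'a \<times> 'b \<Rightarrow> real" where
  "rect_max c A B 0 z = 0"
| "rect_max c A B (Suc n) z = max (rect_max c A B n z) (c n * indicator (A n \<times> B n) z)"

text \<open>Minimum distributes over maximum and rectangles meet in rectangles, so the class is
  closed under minimum with one more weighted rectangle. This drives the recursion max(u,v) = u + v
  - min(u,v) for integrals.\<close>

lemma min_rect_max:
  assumes "\<And>k. 0 \<le> c k" "0 \<le> d"
  shows "min (rect_max c A B n z) (d * indicator (A' \<times> B') z) =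
    rect_max (\<lambda>k. min (c k) d) (\<lambda>k. A k \<inter> A') (\<lambda>k. B k \<inter> B') n z"
proof (induction n)
  case 0 then show ?case using assms by (simp add: indicator_def)
next
  case (Suc n)
  have "min (c n * indicator (A n \<times> B n) z) (d * indicator (A' \<times> B') z) =
    min (c n) d * indicator ((A n \<inter> A') \<times> (B n \<inter> B')) z"
    using assms(1)[of n] assms(2) by (auto simp: indicator_def min_def)
  then show ?case using Suc by (simp add: min_max_distrib1)
qed

lemma rect_max_ge: "k < n \<Longrightarrow> c k * indicator (A k \<times> B k) z \<le> rect_max c A B n z"
  by (induction n) (auto simp: less_Suc_eq le_max_iff_disj)

lemma rect_max_nonneg: "0 \<le> rect_max c A B n z"
  by (induction n) (auto simp: le_max_iff_disj)

lemma rect_max_le: "0 \<le> u \<Longrightarrow> (\<And>k. c k * indicator (A k \<times> B k) z \<le> u) \<Longrightarrow> rect_max c A B n z \<le> u"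
  by (induction n) auto

lemma measurable_rect_max [measurable]:
  fixes A :: "nat \<Rightarrow> 'a::second_countable_topology set" and B :: "nat \<Rightarrow> 'b::second_countable_topology set"
  assumes "\<And>k. A k \<in> sets borel" "\<And>k. B k \<in> sets borel"
  shows "rect_max c A B n \<in> borel_measurable borel"
proof (induction n)
  case (Suc n)
  note [measurable] = Suc borel_rect[OF assms]
  show ?case unfolding rect_max.simps by measurable
qed simp

text \<open>The known object is a pointwise supremum of countably many weighted Borel rectangles,
  spelled out by inequalities; integrals of such functions will be lower semicontinuous in the
  bimeasure.\<close>

definition rect_sup :: "('a::topological_space \<times> 'b::topological_space \<Rightarrow> real) \<Rightarrow> bool" where
  "rect_sup f \<longleftrightarrow> (\<exists>c A B. (\<forall>k. 0 \<le> c k \<and> A k \<in> sets borel \<and> B k \<in> sets borel) \<and>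
     (\<forall>z k. c k * indicator (A k \<times> B k) z \<le> f z) \<and>
     (\<forall>z a. a < f z \<longrightarrow> (\<exists>k::nat. a < c k * indicator (A k \<times> B k) z)))"

lemma rect_supI:
  assumes T: "countable T" "T \<noteq> {}"
    and "\<And>i. i \<in> T \<Longrightarrow> 0 \<le> c i" "\<And>i. i \<in> T \<Longrightarrow> A i \<in> sets borel" "\<And>i. i \<in> T \<Longrightarrow> B i \<in> sets borel"
    and "\<And>i z. i \<in> T \<Longrightarrow> c i * indicator (A i \<times> B i) z \<le> f z"
    and ex: "\<And>z a. a < f z \<Longrightarrow> \<exists>i\<in>T. a < c i * indicator (A i \<times> B i) z"
  shows "rect_sup f"
proof -
  let ?t = "from_nat_into T"
  show ?thesis unfolding rect_sup_def
  proof (rule exI[of _ "\<lambda>k. c (?t k)"], rule exI[of _ "\<lambda>k. A (?t k)"], rule exI[of _ "\<lambda>k. B (?t k)"],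
      intro conjI allI impI)
    fix k z
    have t: "?t k \<in> T" by (rule from_nat_into[OF T(2)])
    then show "0 \<le> c (?t k)" "A (?t k) \<in> sets borel" "B (?t k) \<in> sets borel"
      "c (?t k) * indicator (A (?t k) \<times> B (?t k)) z \<le> f z" using assms by auto
  next
    fix z a assume "a < f z"
    then obtain i where "i \<in> T" "a < c i * indicator (A i \<times> B i) z" using ex by blast
    then show "\<exists>k. a < c (from_nat_into T k) * indicator (A (from_nat_into T k) \<times> B (from_nat_into T k)) z"
      using from_nat_into_surj[OF T(1)] by metis
  qed
qed

text \<open>Wherever f exceeds q, it does so on a basic open rectangle; rational weights and
  countable bases leave countably many candidates.\<close>

lemma rect_sup_continuous:
  fixes f :: "'a::second_countable_topology \<times> 'b::second_countable_topology \<Rightarrow> real"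
  assumes f: "continuous_on UNIV f" and f0: "\<And>z. 0 \<le> f z"
  shows "rect_sup f"
proof -
  obtain X :: "'a set set" where X: "countable X" "topological_basis X" using ex_countable_basis by blast
  obtain Y :: "'b set set" where Y: "countable Y" "topological_basis Y" using ex_countable_basis by blast
  define T where "T = {(q, U, V). q \<in> \<rat> \<and> 0 \<le> q \<and> U \<in> X \<and> V \<in> Y \<and> (\<forall>z\<in>U \<times> V. q \<le> f z)}"
  have ex: "\<exists>i\<in>T. a < fst i * indicator (fst (snd i) \<times> snd (snd i)) z" if "a < f z" for a z
  proof (cases "f z = 0")
    \<comment> \<open>No positive weight fits below f at such a point, so a rectangle of weight 0
      has to attain the supremum.\<close>
    case True
    obtain U where "U \<in> X" using topological_basisE[OF X(2) open_UNIV UNIV_I] by blast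
    moreover obtain V where "V \<in> Y" using topological_basisE[OF Y(2) open_UNIV UNIV_I] by blast
    ultimately have "(0, U, V) \<in> T" using f0 by (auto simp: T_def)
    then show ?thesis using True that by force
  next
    case False
    then have "max a 0 < f z" using that f0[of z] by simp
    then obtain q where q: "q \<in> \<rat>" "max a 0 < q" "q < f z" using Rats_dense_in_real by blast
    have "open {w. q < f w}" using f by (intro open_Collect_less) auto
    then obtain U' V' where UV: "open U'" "open V'" "z \<in> U' \<times> V'" "U' \<times> V' \<subseteq> {w. q < f w}"
      using q(3) by (elim open_prod_elim[where x=z]) auto
    obtain U where U: "U \<in> X" "fst z \<in> U" "U \<subseteq> U'"
      using UV(3) topological_basisE[OF X(2) UV(1)] by (metis mem_Times_iff)
    obtain V where V: "V \<in> Y" "snd z \<in> V" "V \<subseteq> V'"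
      using UV(3) topological_basisE[OF Y(2) UV(2)] by (metis mem_Times_iff)
    have "\<forall>w\<in>U \<times> V. q \<le> f w" using UV(4) U(3) V(3) by (auto simp: subset_iff less_imp_le)
    then have "(q, U, V) \<in> T" using q U V by (simp add: T_def)
    moreover have "z \<in> U \<times> V" using U V by (cases z) auto
    ultimately show ?thesis using q by force
  qed
  have "T \<subseteq> \<rat> \<times> X \<times> Y" by (auto simp: T_def)
  then have cT: "countable T"
    by (rule countable_subset) (intro countable_SIGMA countable_rat X Y)
  show ?thesis
  proof (rule rect_supI[OF cT])
    show "T \<noteq> {}" using ex[of "f undefined - 1" undefined] by auto
    show "fst i * indicator (fst (snd i) \<times> snd (snd i)) z \<le> f z" if "i \<in> T" for i z
      using that f0 by (auto simp: T_def indicator_def)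
  qed (use ex X Y in \<open>auto simp: T_def intro!: borel_open intro: topological_basis_open\<close>)
qed

text \<open>Here the level sets of h take the place of basic open sets, so Borel measurability does
  the work of continuity.\<close>

lemma rect_sup_tensor:
  assumes h: "h \<in> borel_measurable borel" "\<And>x. 0 \<le> h x" and C: "C \<in> sets borel"
  shows "rect_sup (\<lambda>z. h (fst z) * indicator C (snd z))"
proof (rule rect_supI)
  let ?T = "{q\<in>\<rat>. 0 \<le> (q::real)}"
  show "countable ?T" using countable_rat by (rule countable_subset[rotated]) auto
  show "?T \<noteq> {}" by (auto intro: Rats_0)
  show "{x. q < h x} \<in> sets borel" for q using h(1) by measurable
  show "q * indicator ({x. q < h x} \<times> C) z \<le> h (fst z) * indicator C (snd z)" for q z
    using h(2) by (auto simp: indicator_def)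
  fix z a assume a: "a < h (fst z) * indicator C (snd z)"
  show "\<exists>q\<in>?T. a < q * indicator ({x. q < h x} \<times> C) z"
  proof (cases "a < 0")
    case True then show ?thesis by (intro bexI[of _ 0]) auto
  next
    case False
    then have "snd z \<in> C" "a < h (fst z)" using a by (cases "snd z \<in> C"; simp)+
    moreover then obtain q where "q \<in> \<rat>" "a < q" "q < h (fst z)" using Rats_dense_in_real by blast
    ultimately show ?thesis using False by (intro bexI[of _ q]) (auto simp: indicator_def mem_Times_iff)
  qed
qed (use C in auto)

section \<open>The compact space of bimeasures and semicontinuity on it\<close>

context marginals
begin

text \<open>The bounds are imposed on all pairs, including non-measurable sets where
  \<open>bimeasure\<close> says nothing, so that the set lies in the full cube.\<close>

definition bimeasures :: "('e set \<times> 's set \<Rightarrow> real) set" where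
  "bimeasures = {\<beta>. (\<forall>p. 0 \<le> \<beta> p \<and> \<beta> p \<le> 1) \<and> bimeasure \<eta> \<nu> \<beta>}"

definition plan_of :: "('e set \<times> 's set \<Rightarrow> real) \<Rightarrow> ('e \<times> 's) measure" where
  "plan_of \<beta> = (SOME \<gamma>. \<gamma> \<in> transference_plans \<eta> \<nu> \<and>
     (\<forall>A\<in>sets borel. \<forall>B\<in>sets borel. measure \<gamma> (A \<times> B) = \<beta> (A, B)))"

lemma plan_of:
  assumes "\<beta> \<in> bimeasures"
  shows "plan_of \<beta> \<in> transference_plans \<eta> \<nu>"
    and "A \<in> sets borel \<Longrightarrow> B \<in> sets borel \<Longrightarrow> measure (plan_of \<beta>) (A \<times> B) = \<beta> (A, B)"
proof -
  have "bimeasure \<eta> \<nu> \<beta>" using assms by (simp add: bimeasures_def)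
  then have "\<exists>\<gamma>. \<gamma> \<in> transference_plans \<eta> \<nu> \<and>
     (\<forall>A\<in>sets borel. \<forall>B\<in>sets borel. measure \<gamma> (A \<times> B) = \<beta> (A, B))"
    by (rule bimeasure_plan) blast
  then have "plan_of \<beta> \<in> transference_plans \<eta> \<nu> \<and>
     (\<forall>A\<in>sets borel. \<forall>B\<in>sets borel. measure (plan_of \<beta>) (A \<times> B) = \<beta> (A, B))"
    unfolding plan_of_def by (rule someI_ex)
  then show "plan_of \<beta> \<in> transference_plans \<eta> \<nu>"
    "A \<in> sets borel \<Longrightarrow> B \<in> sets borel \<Longrightarrow> measure (plan_of \<beta>) (A \<times> B) = \<beta> (A, B)" by auto
qed

lemma plan_of_measure:
  assumes \<gamma>: "\<gamma> \<in> transference_plans \<eta> \<nu>"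
  obtains \<beta> where "\<beta> \<in> bimeasures" "plan_of \<beta> = \<gamma>"
proof
  let ?\<beta> = "\<lambda>(A, B). measure \<gamma> (A \<times> B)"
  have "prob_space \<gamma>" using \<gamma> by (simp add: plan_iff)
  then show b: "?\<beta> \<in> bimeasures"
    using plan_bimeasure[OF \<gamma>] by (auto simp: bimeasures_def prob_space.prob_le_1)
  show "plan_of ?\<beta> = \<gamma>"
    by (rule plan_eqI[OF plan_of(1)[OF b] \<gamma>]) (use plan_of(2)[OF b] in auto)
qed

lemma prob_space_plan_of: "\<beta> \<in> bimeasures \<Longrightarrow> prob_space (plan_of \<beta>)"
  and sets_plan_of: "\<beta> \<in> bimeasures \<Longrightarrow> sets (plan_of \<beta>) = sets borel"
  using plan_of(1) by (auto simp: plan_iff)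

lemma integrable_plan_of:
  fixes f :: "_ \<Rightarrow> real"
  assumes "\<beta> \<in> bimeasures" "f \<in> borel_measurable borel" "\<And>z. \<bar>f z\<bar> \<le> K"
  shows "integrable (plan_of \<beta>) f"
proof -
  interpret prob_space "plan_of \<beta>" using assms(1) by (rule prob_space_plan_of)
  show ?thesis using assms sets_plan_of[OF assms(1)]
    by (intro integrable_const_bound[where B=K]) (auto cong: measurable_cong_sets)
qed

text \<open>Each axiom is an equation or weak inequality between finitely many coordinates,
  quantified over sets; the side conditions on the sets do not involve
  \<open>\<beta>\<close>.\<close>

lemma closed_bimeasures: "closed bimeasures"
proof -
  have c: "continuous_on UNIV (\<lambda>\<beta> :: 'e set \<times> 's set \<Rightarrow> real. \<beta> p)" for p by simp
  show ?thesis
    unfolding bimeasures_def bimeasure_def bimeasure_axioms_def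
    by (intro closed_Collect_conj closed_Collect_all closed_Collect_imp closed_Collect_le closed_Collect_eq
        continuous_intros c open_Collect_const closed_Collect_const)
qed

lemma compact_bimeasures: "compact bimeasures"
proof -
  have "compact (PiE UNIV (\<lambda>_. {0..1}) :: ('e set \<times> 's set \<Rightarrow> real) set)"
    using compactin_PiE[of "\<lambda>_. euclideanreal" UNIV "\<lambda>_. {0..1}"]
    by (simp add: euclidean_product_topology)
  then have "compact (PiE UNIV (\<lambda>_. {0..1}) \<inter> bimeasures)"
    using closed_bimeasures by (rule compact_Int_closed)
  moreover have "PiE UNIV (\<lambda>_. {0..1}) \<inter> bimeasures = bimeasures" by (auto simp: bimeasures_def)
  ultimately show ?thesis by simp
qed

text \<open>Inclusion-exclusion: by max(u,v) = u + v - min(u,v) the integral reduces to finitely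
  many coordinates of \<open>\<beta>\<close>. The minimum has other weights and sets, whence the
  induction over arbitrary \<open>c\<close>, \<open>A\<close>, \<open>B\<close>.\<close>

lemma continuous_on_rect_max:
  assumes "\<And>k. 0 \<le> c k" "\<And>k. A k \<in> sets borel" "\<And>k. B k \<in> sets borel"
  shows "continuous_on bimeasures (\<lambda>\<beta>. \<integral>z. rect_max c A B n z \<partial>plan_of \<beta>)"
  using assms
proof (induction n arbitrary: c A B)
  case 0
  have "rect_max c A B 0 = (\<lambda>_. 0)" by (simp add: fun_eq_iff)
  then show ?case by simp
next
  case (Suc n)
  let ?m = "rect_max (\<lambda>k. min (c k) (c n)) (\<lambda>k. A k \<inter> A n) (\<lambda>k. B k \<inter> B n) n"
  have "(\<integral>z. rect_max c A B (Suc n) z \<partial>plan_of \<beta>) =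
     (\<integral>z. rect_max c A B n z \<partial>plan_of \<beta>) + c n * \<beta> (A n, B n) - (\<integral>z. ?m z \<partial>plan_of \<beta>)"
    if \<beta>: "\<beta> \<in> bimeasures" for \<beta>
  proof -
    interpret P: prob_space "plan_of \<beta>" using \<beta> by (rule prob_space_plan_of)
    have s: "sets (plan_of \<beta>) = sets borel" using \<beta> by (rule sets_plan_of)
    have int: "integrable (plan_of \<beta>) (rect_max c' A' B' k)"
      if "\<And>k. 0 \<le> c' k" "\<And>k. A' k \<in> sets borel" "\<And>k. B' k \<in> sets borel" for c' A' B' k
    proof (rule integrable_plan_of[OF \<beta> measurable_rect_max])
      fix z
      \<comment> \<open>Enlarging every rectangle to the whole space gives a bound that does not
        depend on z.\<close>
      have "rect_max c' A' B' k z \<le> rect_max c' (\<lambda>_. UNIV) (\<lambda>_. UNIV) k (undefined, undefined)"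
        using that(1) by (induction k) (auto simp: indicator_def le_max_iff_disj rect_max_nonneg)
      then show "\<bar>rect_max c' A' B' k z\<bar> \<le> rect_max c' (\<lambda>_. UNIV) (\<lambda>_. UNIV) k (undefined, undefined)"
        by (simp add: rect_max_nonneg)
    qed (use that in auto)
    have R: "A n \<times> B n \<in> sets (plan_of \<beta>)" using Suc.prems by (simp add: s borel_rect)
    then have iR: "integrable (plan_of \<beta>) (indicat_real (A n \<times> B n))"
      by (intro integrable_real_indicator) (auto simp: P.emeasure_eq_measure)
    have "rect_max c A B (Suc n) z = rect_max c A B n z + c n * indicator (A n \<times> B n) z - ?m z" for z
      using Suc.prems by (subst min_rect_max[symmetric]) auto
    then have "(\<integral>z. rect_max c A B (Suc n) z \<partial>plan_of \<beta>) =
      (\<integral>z. rect_max c A B n z + c n * indicator (A n \<times> B n) z - ?m z \<partial>plan_of \<beta>)" by presburger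
    also have "\<dots> = (\<integral>z. rect_max c A B n z \<partial>plan_of \<beta>) + c n * measure (plan_of \<beta>) (A n \<times> B n)
       - (\<integral>z. ?m z \<partial>plan_of \<beta>)"
      using Suc.prems R by (subst Bochner_Integration.integral_diff Bochner_Integration.integral_add;
        auto intro!: int iR Bochner_Integration.integrable_add)+
    finally show ?thesis using plan_of(2)[OF \<beta>] Suc.prems by simp
  qed
  moreover have "continuous_on bimeasures (\<lambda>\<beta>. (\<integral>z. rect_max c A B n z \<partial>plan_of \<beta>) + c n * \<beta> (A n, B n)
      - (\<integral>z. ?m z \<partial>plan_of \<beta>))"
    using Suc.prems
    by (intro continuous_intros Suc.IH continuous_on_subset[OF continuous_on_product_coordinates subset_UNIV]) auto
  ultimately show ?case by (simp cong: continuous_on_cong)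
qed

text \<open>Some finite maximum already has integral above a at \<open>\<beta>0\<close>. Its
  integral is continuous in \<open>\<beta>\<close> and stays below that of f.\<close>

lemma rect_sup_lsc:
  assumes f: "rect_sup f" and fm [measurable]: "f \<in> borel_measurable borel" and fK: "\<And>z. f z \<le> K"
    and \<beta>0: "\<beta>0 \<in> bimeasures" and a: "a < (\<integral>z. f z \<partial>plan_of \<beta>0)"
  shows "\<forall>\<^sub>F \<beta> in at \<beta>0 within bimeasures. a < (\<integral>z. f z \<partial>plan_of \<beta>)"
proof -
  obtain c A B where c: "\<And>k. 0 \<le> c k" and AB: "\<And>k. A k \<in> sets borel" "\<And>k. B k \<in> sets borel"
    and le: "\<And>z k. c k * indicator (A k \<times> B k) z \<le> f z"
    and ex: "\<And>z a. a < f z \<Longrightarrow> \<exists>k::nat. a < c k * indicator (A k \<times> B k) z"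
    using f unfolding rect_sup_def by metis
  have f0: "0 \<le> f z" for z
    using c[of 0] le[of 0 z] by (smt (verit) mult_nonneg_nonneg indicator_pos_le)
  have rle: "rect_max c A B n z \<le> f z" for n z by (intro rect_max_le f0 le)
  then have rK: "rect_max c A B n z \<le> K" for n z using fK order_trans by blast
  have [measurable]: "rect_max c A B n \<in> borel_measurable borel" for n
    by (rule measurable_rect_max[OF AB])
  have lim: "(\<lambda>n. rect_max c A B n z) \<longlonglongrightarrow> f z" for z
  proof (rule order_tendstoI)
    fix a assume "a < f z"
    then obtain k where "a < c k * indicator (A k \<times> B k) z" using ex by blast
    then have "a < rect_max c A B n z" if "Suc k \<le> n" for n
      using rect_max_ge[of k n c A B z] that by simp
    then show "\<forall>\<^sub>F n in sequentially. a < rect_max c A B n z"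
      unfolding eventually_sequentially by blast
  next
    fix a assume "f z < a" then show "\<forall>\<^sub>F n in sequentially. rect_max c A B n z < a"
      using rle le_less_trans by (intro always_eventually) blast
  qed
  have int: "integrable (plan_of \<beta>) f" "integrable (plan_of \<beta>) (rect_max c A B n)" if "\<beta> \<in> bimeasures" for \<beta> n
    using f0 fK rK[of n] rect_max_nonneg[of c A B n]
    by (auto intro!: integrable_plan_of[OF that, where K=K])
  have "(\<lambda>n. \<integral>z. rect_max c A B n z \<partial>plan_of \<beta>0) \<longlonglongrightarrow> (\<integral>z. f z \<partial>plan_of \<beta>0)"
    using sets_plan_of[OF \<beta>0] f0 rle
    by (intro integral_dominated_convergence[where w=f] int \<beta>0)
      (auto simp: lim rect_max_nonneg cong: measurable_cong_sets)
  from order_tendstoD(1)[OF this a] obtain n where n: "a < (\<integral>z. rect_max c A B n z \<partial>plan_of \<beta>0)"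
    by (auto simp: eventually_sequentially)
  have "((\<lambda>\<beta>. \<integral>z. rect_max c A B n z \<partial>plan_of \<beta>) \<longlongrightarrow> (\<integral>z. rect_max c A B n z \<partial>plan_of \<beta>0))
      (at \<beta>0 within bimeasures)"
    using continuous_on_rect_max[of c A B n] c AB \<beta>0 by (auto simp: continuous_on_def)
  from order_tendstoD(1)[OF this n]
  have "\<forall>\<^sub>F \<beta> in at \<beta>0 within bimeasures. a < (\<integral>z. rect_max c A B n z \<partial>plan_of \<beta>)" .
  moreover have "\<forall>\<^sub>F \<beta> in at \<beta>0 within bimeasures. \<beta> \<in> bimeasures"
    by (auto simp: eventually_at_filter)
  ultimately show ?thesis
  proof eventually_elim
    case (elim \<beta>)
    have "(\<integral>z. rect_max c A B n z \<partial>plan_of \<beta>) \<le> (\<integral>z. f z \<partial>plan_of \<beta>)"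
      by (intro integral_mono int elim rle)
    then show ?case using elim by simp
  qed
qed

text \<open>Upper semicontinuity for f is lower semicontinuity for g, because the two integrals have
  a constant sum.\<close>

lemma continuous_on_rect_sup:
  assumes f: "rect_sup f" "f \<in> borel_measurable borel" "\<And>z. f z \<le> K"
    and g: "rect_sup g" "g \<in> borel_measurable borel" "\<And>z. g z \<le> K"
    and sum: "\<And>\<beta>. \<beta> \<in> bimeasures \<Longrightarrow> (\<integral>z. f z \<partial>plan_of \<beta>) + (\<integral>z. g z \<partial>plan_of \<beta>) = d"
  shows "continuous_on bimeasures (\<lambda>\<beta>. \<integral>z. f z \<partial>plan_of \<beta>)"
  unfolding continuous_on_def
proof (intro ballI order_tendstoI)
  fix \<beta>0 assume \<beta>0: "\<beta>0 \<in> bimeasures"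
  show "\<forall>\<^sub>F \<beta> in at \<beta>0 within bimeasures. a < (\<integral>z. f z \<partial>plan_of \<beta>)"
    if "a < (\<integral>z. f z \<partial>plan_of \<beta>0)" for a
    by (rule rect_sup_lsc[OF f \<beta>0 that])
  fix a assume "(\<integral>z. f z \<partial>plan_of \<beta>0) < a"
  then have "d - a < (\<integral>z. g z \<partial>plan_of \<beta>0)" using sum[OF \<beta>0] by simp
  from rect_sup_lsc[OF g \<beta>0 this]
  have "\<forall>\<^sub>F \<beta> in at \<beta>0 within bimeasures. d - a < (\<integral>z. g z \<partial>plan_of \<beta>)" .
  moreover have "\<forall>\<^sub>F \<beta> in at \<beta>0 within bimeasures. \<beta> \<in> bimeasures"
    by (auto simp: eventually_at_filter)
  ultimately show "\<forall>\<^sub>F \<beta> in at \<beta>0 within bimeasures. (\<integral>z. f z \<partial>plan_of \<beta>) < a"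
    by eventually_elim (use sum in fastforce)
qed

end

section \<open>Separation of probabilities by bounded continuous functions\<close>

text \<open>The indicator of a closed set is a limit of bounded continuous functions of the distance
  to it, and the closed sets are an intersection-stable generator.\<close>

lemma borel_probs_eqI:
  fixes \<mu> \<mu>' :: "'a::metric_space measure"
  assumes "\<mu> \<in> borel_probs" "\<mu>' \<in> borel_probs"
    and eq: "\<And>f :: 'a \<Rightarrow>\<^sub>C real. (\<integral>x. f x \<partial>\<mu>) = (\<integral>x. f x \<partial>\<mu>')"
  shows "\<mu> = \<mu>'"
proof -
  have closed_lim: "(\<lambda>n. \<integral>x. max 0 (1 - real n * infdist x F) \<partial>M) \<longlonglongrightarrow> measure M F"
    if M: "M \<in> borel_probs" and F: "closed F" "F \<noteq> {}" for M and F :: "'a set"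
  proof -
    interpret prob_space M using M by (simp add: borel_probs_iff)
    have [measurable_cong]: "sets M = sets borel" using M by (simp add: borel_probs_iff)
    have [measurable]: "F \<in> sets borel" using F by auto
    have [measurable]: "(\<lambda>x. infdist x F) \<in> borel_measurable borel"
      by (intro borel_measurable_continuous_onI continuous_intros)
    have "(\<lambda>n. \<integral>x. max 0 (1 - real n * infdist x F) \<partial>M) \<longlonglongrightarrow> (\<integral>x. indicator F x \<partial>M)"
    proof (rule integral_dominated_convergence[where w="\<lambda>_. 1"])
      show "AE x in M. (\<lambda>n. max 0 (1 - real n * infdist x F)) \<longlonglongrightarrow> indicator F x"
      proof (rule AE_I2)
        fix x
        show "(\<lambda>n. max 0 (1 - real n * infdist x F)) \<longlonglongrightarrow> indicator F x"
        proof (cases "x \<in> F")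
          case True then show ?thesis by simp
        next
          case False
          then have "0 < infdist x F"
            using in_closed_iff_infdist_zero[OF F, of x] infdist_nonneg[of x F] by auto
          then obtain N where N: "1 < real N * infdist x F" using reals_Archimedean3 by blast
          have "max 0 (1 - real n * infdist x F) = 0" if "n \<ge> N" for n
          proof -
            have "real N * infdist x F \<le> real n * infdist x F"
              using that by (intro mult_right_mono infdist_nonneg) auto
            then show ?thesis using N by simp
          qed
          then show ?thesis using False
            by (intro tendsto_eventually) (auto simp: eventually_sequentially)
        qed
      qed
      show "AE x in M. norm (max 0 (1 - real n * infdist x F)) \<le> 1" for n
        by (simp add: infdist_nonneg)
    qed auto
    then show ?thesis by simp
  qed
  have closed_eq: "measure \<mu> F = measure \<mu>' F" if F: "closed F" for F
  \<comment> \<open>The empty set is separate because \<open>infdist x {}\<close> is 0, so the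
    approximating functions would be constantly 1.\<close>
  proof (cases "F = {}")
    case False
    have "(\<integral>x. max 0 (1 - real n * infdist x F) \<partial>\<mu>) = (\<integral>x. max 0 (1 - real n * infdist x F) \<partial>\<mu>')" for n
    proof -
      have "(\<lambda>x. max 0 (1 - real n * infdist x F)) \<in> bcontfun"
        by (rule bcontfun_normI[of _ 1]) (auto intro!: continuous_intros simp: infdist_nonneg)
      then show ?thesis using eq[of "Bcontfun (\<lambda>x. max 0 (1 - real n * infdist x F))"]
        by (simp add: Bcontfun_inverse)
    qed
    then show ?thesis
      using closed_lim[OF assms(1) F False] closed_lim[OF assms(2) F False] LIMSEQ_unique by simp
  qed simp
  interpret \<mu>: prob_space \<mu> using assms by (simp add: borel_probs_iff)
  interpret \<mu>': prob_space \<mu>' using assms by (simp add: borel_probs_iff)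
  have s: "sets (borel :: 'a measure) = sigma_sets UNIV (Collect closed)"
    by (subst borel_eq_closed) simp
  show ?thesis
  proof (rule measure_eqI_generator_eq[where \<Omega>=UNIV and E="Collect closed" and A="\<lambda>_. UNIV"])
    show "Int_stable (Collect closed :: 'a set set)" by (auto simp: Int_stable_def)
    show "emeasure \<mu> X = emeasure \<mu>' X" if "X \<in> Collect closed" for X
      using closed_eq that by (simp add: \<mu>.emeasure_eq_measure \<mu>'.emeasure_eq_measure)
  qed (use assms s in \<open>auto simp: borel_probs_iff\<close>)
qed

lemma Hausdorff_weak_topology: "Hausdorff_space (weak_topology :: 'a::metric_space measure topology)"
  unfolding Hausdorff_space_def
proof (intro allI impI)
  fix \<mu> \<mu>' :: "'a measure"
  assume "\<mu> \<in> topspace weak_topology \<and> \<mu>' \<in> topspace weak_topology \<and> \<mu> \<noteq> \<mu>'"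
  then have m: "\<mu> \<in> borel_probs" "\<mu>' \<in> borel_probs" "\<mu> \<noteq> \<mu>'" by auto
  then obtain f :: "'a \<Rightarrow>\<^sub>C real" where ne: "(\<integral>x. f x \<partial>\<mu>) \<noteq> (\<integral>x. f x \<partial>\<mu>')"
    using borel_probs_eqI by blast
  then obtain U V where UV: "open U" "open V" "(\<integral>x. f x \<partial>\<mu>) \<in> U" "(\<integral>x. f x \<partial>\<mu>') \<in> V" "U \<inter> V = {}"
    using hausdorff[OF ne] by metis
  have op: "openin weak_topology {\<mu> \<in> borel_probs. (\<integral>x. f x \<partial>\<mu>) \<in> U}" if U: "open U" for U
  proof -
    have "open ((\<lambda>F :: ('a \<Rightarrow>\<^sub>C real) \<Rightarrow> real. F f) -` U)"
      by (rule open_vimage[OF U continuous_on_product_coordinates])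
    then show ?thesis unfolding weak_topology_def openin_pullback_topology
      by (intro exI[of _ "(\<lambda>F :: ('a \<Rightarrow>\<^sub>C real) \<Rightarrow> real. F f) -` U"]) auto
  qed
  show "\<exists>U V. openin weak_topology U \<and> openin weak_topology V \<and> \<mu> \<in> U \<and> \<mu>' \<in> V \<and> disjnt U V"
    using UV m op[OF UV(1)] op[OF UV(2)]
    by (intro exI[of _ "{\<mu> \<in> borel_probs. (\<integral>x. f x \<partial>\<mu>) \<in> U}"] exI[of _ "{\<mu> \<in> borel_probs. (\<integral>x. f x \<partial>\<mu>) \<in> V}"])
       (auto simp: disjnt_def)
qed

section \<open>Integrals continuous in the bimeasure, and compact sets of plans\<close>

context marginals
begin

lemma borel_measurable_tensor:
  assumes [measurable]: "h \<in> borel_measurable borel" "C \<in> sets borel"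
  shows "(\<lambda>z. h (fst z) * indicator C (snd z) :: real) \<in> borel_measurable (borel :: ('e \<times> 's) measure)"
  unfolding borel_prod[symmetric] by measurable

text \<open>The complementary integrand is (1 - h(x)) 1_C(y). The sum is 1_C(y), whose integral is
  fixed by the second marginal.\<close>

lemma continuous_on_tensor:
  fixes h :: "'e \<Rightarrow> real"
  assumes h: "h \<in> borel_measurable borel" "\<And>x. 0 \<le> h x" "\<And>x. h x \<le> 1" and C: "C \<in> sets borel"
  shows "continuous_on bimeasures (\<lambda>\<beta>. \<integral>z. h (fst z) * indicator C (snd z) \<partial>plan_of \<beta>)"
proof (rule continuous_on_rect_sup[where K=1 and d="measure \<nu> C" and g="\<lambda>z. (1 - h (fst z)) * indicator C (snd z)"])
  have h': "(\<lambda>x. 1 - h x) \<in> borel_measurable borel" using h(1) by measurable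
  show m: "(\<lambda>z. h (fst z) * indicator C (snd z)) \<in> borel_measurable borel"
    "(\<lambda>z. (1 - h (fst z)) * indicator C (snd z)) \<in> borel_measurable borel"
    using borel_measurable_tensor[OF h(1) C] borel_measurable_tensor[OF h' C] by auto
  show "rect_sup (\<lambda>z. h (fst z) * indicator C (snd z))" "rect_sup (\<lambda>z. (1 - h (fst z)) * indicator C (snd z))"
    using rect_sup_tensor[OF h(1,2) C] rect_sup_tensor[OF h' _ C] h(3) by auto
  show le: "h (fst z) * indicator C (snd z) \<le> 1" "(1 - h (fst z)) * indicator C (snd z) \<le> 1" for z
    using h by (auto simp: indicator_def)
  fix \<beta> assume \<beta>: "\<beta> \<in> bimeasures"
  interpret prob_space "plan_of \<beta>" using \<beta> by (rule prob_space_plan_of)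
  have UC: "UNIV \<times> C \<in> sets (plan_of \<beta>)" using C sets_plan_of[OF \<beta>] borel_rect[of UNIV C] by simp
  have "(\<integral>z. h (fst z) * indicator C (snd z) \<partial>plan_of \<beta>) + (\<integral>z. (1 - h (fst z)) * indicator C (snd z) \<partial>plan_of \<beta>)
    = (\<integral>z. h (fst z) * indicator C (snd z) + (1 - h (fst z)) * indicator C (snd z) \<partial>plan_of \<beta>)"
    using h by (intro Bochner_Integration.integral_add[symmetric] integrable_plan_of[OF \<beta>, where K=1] m)
      (auto simp: indicator_def)
  also have "\<dots> = (\<integral>z. indicator (UNIV \<times> C) z \<partial>plan_of \<beta>)"
    by (intro Bochner_Integration.integral_cong refl) (auto simp: indicator_def)
  also have "\<dots> = measure \<nu> C"
    using UC plan_of(1)[OF \<beta>] C by (simp add: plan_iff)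
  finally show "(\<integral>z. h (fst z) * indicator C (snd z) \<partial>plan_of \<beta>)
    + (\<integral>z. (1 - h (fst z)) * indicator C (snd z) \<partial>plan_of \<beta>) = measure \<nu> C" .
qed

text \<open>With K the norm of f, both K + f and K - f are nonnegative and continuous, and their sum
  is the constant 2 K.\<close>

lemma continuous_on_bcontfun:
  fixes f :: "('e \<times> 's) \<Rightarrow>\<^sub>C real"
  shows "continuous_on bimeasures (\<lambda>\<beta>. \<integral>z. f z \<partial>plan_of \<beta>)"
proof -
  define K where "K = norm f"
  have fK: "\<bar>f z\<bar> \<le> K" for z unfolding K_def using norm_bounded[of f z] by simp
  have fc: "continuous_on UNIV f" by (rule continuous_on_apply_bcontfun)
  have fm [measurable]: "apply_bcontfun f \<in> borel_measurable borel"
    by (rule borel_measurable_continuous_onI[OF fc])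
  have "continuous_on bimeasures (\<lambda>\<beta>. \<integral>z. K + f z \<partial>plan_of \<beta>)"
  proof (rule continuous_on_rect_sup[where K="2 * K" and d="2 * K" and g="\<lambda>z. K - f z"])
    have "0 \<le> K + f z" "0 \<le> K - f z" for z using fK[of z] by auto
    then show "rect_sup (\<lambda>z. K + f z)" "rect_sup (\<lambda>z. K - f z)"
      by (intro rect_sup_continuous continuous_on_add continuous_on_diff continuous_on_const fc; simp)+
    show "K + f z \<le> 2 * K" "K - f z \<le> 2 * K" for z using fK[of z] by auto
    fix \<beta> assume \<beta>: "\<beta> \<in> bimeasures"
    interpret prob_space "plan_of \<beta>" using \<beta> by (rule prob_space_plan_of)
    show "(\<integral>z. K + f z \<partial>plan_of \<beta>) + (\<integral>z. K - f z \<partial>plan_of \<beta>) = 2 * K"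
      using integrable_plan_of[OF \<beta> fm fK] prob_space by simp
  qed auto
  then have "continuous_on bimeasures (\<lambda>\<beta>. (\<integral>z. K + f z \<partial>plan_of \<beta>) - K)" by (intro continuous_intros)
  moreover have "(\<integral>z. K + f z \<partial>plan_of \<beta>) - K = (\<integral>z. f z \<partial>plan_of \<beta>)" if \<beta>: "\<beta> \<in> bimeasures" for \<beta>
  proof -
    interpret prob_space "plan_of \<beta>" using \<beta> by (rule prob_space_plan_of)
    show ?thesis using integrable_plan_of[OF \<beta> fm fK] prob_space by simp
  qed
  ultimately show ?thesis by (simp cong: continuous_on_cong)
qed

text \<open>Every triple in W is an equation between continuous functions of the bimeasure, so W
  cuts out a compact set of bimeasures, and \<open>plan_of\<close> maps it continuously onto the set
  of plans. For causality, h will be a conditional probability of A.\<close>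

lemma compactin_plans:
  assumes W: "\<And>h A C. (h, A, C) \<in> W \<Longrightarrow> h \<in> borel_measurable borel \<and> (\<forall>x. 0 \<le> h x \<and> h x \<le> 1) \<and>
      A \<in> sets borel \<and> C \<in> sets borel"
  shows "compactin weak_topology {\<gamma> \<in> transference_plans \<eta> \<nu>.
     \<forall>(h, A, C)\<in>W. measure \<gamma> (A \<times> C) = (\<integral>z. h (fst z) * indicator C (snd z) \<partial>\<gamma>)}"
    (is "compactin _ ?P")
proof -
  define F where "F w \<beta> = (case w of (h, A, C) \<Rightarrow>
    \<beta> (A, C) - (\<integral>z. h (fst z) * indicator C (snd z) \<partial>plan_of \<beta>))"
    for w :: "('e \<Rightarrow> real) \<times> 'e set \<times> 's set" and \<beta>
  define X where "X = bimeasures \<inter> (\<Inter>w\<in>W. bimeasures \<inter> F w -` {0})"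
  have "compact X" unfolding X_def
  proof (intro compact_Int_closed compact_bimeasures closed_INT ballI)
    fix w assume w: "w \<in> W"
    obtain h A C where wh: "w = (h, A, C)" by (cases w)
    have "continuous_on bimeasures (F w)" unfolding F_def wh prod.case
      using W[of h A C] w wh
      by (intro continuous_intros continuous_on_tensor continuous_on_subset[OF continuous_on_product_coordinates subset_UNIV]) auto
    then show "closed (bimeasures \<inter> F w -` {0})"
      by (rule continuous_closed_preimage) (auto intro: closed_bimeasures)
  qed
  \<comment> \<open>The weak topology is a pullback from a product, so continuity is checked one
    bounded continuous function at a time.\<close>
  moreover have "continuous_map (top_of_set X) weak_topology plan_of"
    unfolding weak_topology_def
  proof (rule continuous_map_pullback')
    have "continuous_on X (\<lambda>\<beta> (f :: ('e \<times> 's) \<Rightarrow>\<^sub>C real). \<integral>z. f z \<partial>plan_of \<beta>)"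
      by (intro continuous_on_coordinatewise_then_product continuous_on_subset[OF continuous_on_bcontfun])
         (auto simp: X_def)
    then show "continuous_map (top_of_set X) euclidean ((\<lambda>\<mu> (f :: ('e \<times> 's) \<Rightarrow>\<^sub>C real). \<integral>x. f x \<partial>\<mu>) \<circ> plan_of)"
      by (simp add: comp_def)
    show "topspace (top_of_set X) \<subseteq> plan_of -` borel_probs"
      using plan_of(1) by (auto simp: X_def transference_plans_def)
  qed
  ultimately have "compactin weak_topology (plan_of ` X)"
    by (intro image_compactin[of "top_of_set X"]) (auto simp: compactin_subtopology)
  also have "plan_of ` X = ?P"
  proof (intro subset_antisym subsetI)
    fix \<gamma> assume "\<gamma> \<in> plan_of ` X"
    then obtain \<beta> where \<beta>: "\<beta> \<in> X" "\<gamma> = plan_of \<beta>" by auto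
    then have b: "\<beta> \<in> bimeasures" by (simp add: X_def)
    have "measure \<gamma> (A \<times> C) = (\<integral>z. h (fst z) * indicator C (snd z) \<partial>\<gamma>)" if w: "(h, A, C) \<in> W" for h A C
    proof -
      have "\<beta> \<in> F (h, A, C) -` {0}" using \<beta>(1) w unfolding X_def by blast
      then show ?thesis using plan_of(2)[OF b] W[OF w] \<beta>(2) by (simp add: F_def)
    qed
    then show "\<gamma> \<in> ?P" using plan_of(1)[OF b] \<beta>(2) by auto
  next
    fix \<gamma> assume \<gamma>: "\<gamma> \<in> ?P"
    then obtain \<beta> where \<beta>: "\<beta> \<in> bimeasures" "plan_of \<beta> = \<gamma>" using plan_of_measure by blast
    have "F w \<beta> = 0" if "w \<in> W" for w
    proof -
      obtain h A C where wh: "w = (h, A, C)" by (cases w)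
      then have w: "(h, A, C) \<in> W" using that by simp
      have "measure \<gamma> (A \<times> C) = (\<integral>z. h (fst z) * indicator C (snd z) \<partial>\<gamma>)" using \<gamma> w by auto
      then show ?thesis using plan_of(2)[OF \<beta>(1)] W[OF w] \<beta>(2) by (simp add: F_def wh)
    qed
    then have "\<beta> \<in> X" using \<beta>(1) by (auto simp: X_def)
    then show "\<gamma> \<in> plan_of ` X" using \<beta>(2) by blast
  qed
  finally show ?thesis .
qed

end

section \<open>Causality as a family of affine conditions\<close>

text \<open>The sets with an almost sure version in F form a sigma-field that contains F and the
  negligible sets.\<close>

lemma completed_sets_AE:
  assumes F: "subalgebra \<eta> F" and A: "A \<in> completed_sets \<eta> (sets F)"
  obtains A' where "A' \<in> sets F" "AE x in \<eta>. x \<in> A \<longleftrightarrow> x \<in> A'"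
proof -
  have "\<exists>A'\<in>sets F. AE x in \<eta>. x \<in> A \<longleftrightarrow> x \<in> A'"
    using A unfolding completed_sets_def
  proof (induction rule: sigma_sets.induct)
    case (Basic A)
    then show ?case
    proof
      assume "A \<in> {N. \<exists>N'\<in>null_sets \<eta>. N \<subseteq> N'}"
      then obtain N' where "N' \<in> null_sets \<eta>" "A \<subseteq> N'" by auto
      then have "AE x in \<eta>. x \<in> A \<longleftrightarrow> x \<in> {}" by (intro AE_I'[of N']) auto
      then show ?thesis by blast
    qed auto
  next
    case Empty
    then show ?case by (intro bexI[of _ "{}"]) auto
  next
    case (Compl A)
    then obtain A' where A': "A' \<in> sets F" "AE x in \<eta>. x \<in> A \<longleftrightarrow> x \<in> A'" by blast
    have "AE x in \<eta>. x \<in> space \<eta> - A \<longleftrightarrow> x \<in> space F - A'"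
      using A'(2) F by (auto simp: subalgebra_def)
    then show ?case using A'(1) by blast
  next
    case (Union A)
    then obtain A' where A': "\<And>i. A' i \<in> sets F" "\<And>i. AE x in \<eta>. x \<in> A i \<longleftrightarrow> x \<in> A' i" by metis
    have "AE x in \<eta>. \<forall>i. x \<in> A i \<longleftrightarrow> x \<in> A' i" using A'(2) by (simp add: AE_all_countable)
    then have "AE x in \<eta>. x \<in> (\<Union>i. A i) \<longleftrightarrow> x \<in> (\<Union>i. A' i)" by eventually_elim auto
    then show ?case using A'(1) by (intro bexI[of _ "\<Union>i. A' i"]) auto
  qed
  then show thesis using that by blast
qed

lemma completed_sets_AE_I:
  assumes F: "subalgebra \<eta> F" and A': "A' \<in> sets F" and A: "A \<subseteq> space \<eta>"
    and ae: "AE x in \<eta>. x \<in> A \<longleftrightarrow> x \<in> A'"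
  shows "A \<in> completed_sets \<eta> (sets F)"
proof -
  let ?G = "sets F \<union> {N. \<exists>N'\<in>null_sets \<eta>. N \<subseteq> N'}"
  have "sets F \<subseteq> Pow (space \<eta>)" using F sets.space_closed[of F] by (simp add: subalgebra_def)
  moreover have "N \<subseteq> space \<eta>" if "N' \<in> null_sets \<eta>" "N \<subseteq> N'" for N N'
    using sets.sets_into_space[OF null_setsD2[OF that(1)]] that(2) by (rule order_trans[rotated])
  ultimately have sub: "?G \<subseteq> Pow (space \<eta>)" by blast
  obtain N where N: "{x \<in> space \<eta>. \<not> (x \<in> A \<longleftrightarrow> x \<in> A')} \<subseteq> N" "N \<in> null_sets \<eta>"
    using ae by (auto simp: eventually_ae_filter)
  interpret sigma_algebra "space \<eta>" "completed_sets \<eta> (sets F)"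
    unfolding completed_sets_def by (rule sigma_algebra_sigma_sets[OF sub])
  have basic: "X \<in> completed_sets \<eta> (sets F)" if "X \<in> ?G" for X
    unfolding completed_sets_def using that by (rule sigma_sets.Basic)
  \<comment> \<open>A is recovered from its version by removing one negligible set and adding
    another.\<close>
  have eq: "(A' - (A' - A)) \<union> (A - A') = A" by auto
  have "A' \<subseteq> space \<eta>" using A' F sets.sets_into_space[of A' F] by (simp add: subalgebra_def)
  then have "A' - A \<subseteq> N" "A - A' \<subseteq> N" using N(1) A by auto
  then have "A' - A \<in> ?G" "A - A' \<in> ?G" using N(2) by blast+
  moreover have "A' \<in> ?G" using A' by simp
  ultimately have "(A' - (A' - A)) \<union> (A - A') \<in> completed_sets \<eta> (sets F)"
    by (intro Un[OF Diff[OF basic basic] basic])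
  then show ?thesis by (simp only: eq)
qed

text \<open>Replacing each rational superlevel set of f by an F-measurable version and rebuilding
  the function from these sets costs only countably many null sets.\<close>

lemma AE_subalgebra_measurable:
  fixes f :: "'a \<Rightarrow> real"
  assumes F: "subalgebra \<eta> F" and f01: "\<And>x. 0 \<le> f x" "\<And>x. f x \<le> 1"
    and f: "\<And>D. D \<in> sets borel \<Longrightarrow> f -` D \<in> completed_sets \<eta> (sets F)"
  obtains g where "g \<in> borel_measurable F" "AE x in \<eta>. f x = g x"
proof -
  \<comment> \<open>Restricting to [0,1] bounds the supremum; the index 0 makes it nonnegative, so
    that a rational strictly between g x and f x lies in Q.\<close>
  define Q where "Q = \<rat> \<inter> {0..1::real}"
  have Q: "countable Q" "0 \<in> Q" by (auto simp: Q_def countable_rat)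
  have "\<exists>A'\<in>sets F. AE x in \<eta>. q < f x \<longleftrightarrow> x \<in> A'" for q
    using completed_sets_AE[OF F f[of "{q<..}"]] by auto
  then obtain A where A [measurable]: "\<And>q. A q \<in> sets F" and ae: "\<And>q. AE x in \<eta>. q < f x \<longleftrightarrow> x \<in> A q"
    by metis
  define g where "g x = (SUP q\<in>Q. q * indicator (A q) x)" for x
  have "AE x in \<eta>. \<forall>q\<in>Q. q < f x \<longleftrightarrow> x \<in> A q"
    using ae Q by (simp add: AE_ball_countable)
  then have "AE x in \<eta>. f x = g x"
  proof eventually_elim
    case (elim x)
    have bdd: "bdd_above ((\<lambda>q. q * indicator (A q) x) ` Q)"
      by (intro bdd_aboveI[of _ 1]) (auto simp: Q_def indicator_def)
    have "g x \<le> f x" unfolding g_def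
    proof (rule cSUP_least)
      show "q * indicator (A q) x \<le> f x" if "q \<in> Q" for q
        using elim that f01 by (auto simp: indicator_def Q_def less_imp_le)
    qed (use Q in auto)
    moreover have "f x \<le> g x"
    proof (rule ccontr)
      assume "\<not> f x \<le> g x"
      then obtain q where q: "q \<in> \<rat>" "g x < q" "q < f x" using Rats_dense_in_real[of "g x" "f x"] by auto
      have "0 * indicator (A 0) x \<le> g x" unfolding g_def by (rule cSUP_upper[OF Q(2) bdd])
      then have qQ: "q \<in> Q" using q f01(2)[of x] by (auto simp: Q_def)
      have "q * indicator (A q) x \<le> g x" unfolding g_def by (rule cSUP_upper[OF qQ bdd])
      then show False using elim qQ q by auto
    qed
    ultimately show ?case by simp
  qed
  moreover have "g \<in> borel_measurable F" unfolding g_def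
    by (rule borel_measurable_cSUP[OF Q(1)]) (auto intro!: bdd_aboveI[of _ 1] simp: Q_def indicator_def)
  ultimately show thesis using that by blast
qed

text \<open>Conditional expectations are only almost surely in the unit interval; clamping makes the bounds
  hold everywhere.\<close>

definition clamped_cond :: "'a measure \<Rightarrow> 'a measure \<Rightarrow> 'a set \<Rightarrow> 'a \<Rightarrow> real" where
  "clamped_cond \<eta> F A x = max 0 (min 1 (real_cond_exp \<eta> F (indicator A) x))"

lemma clamped_cond_bounds: "0 \<le> clamped_cond \<eta> F A x" "clamped_cond \<eta> F A x \<le> 1"
  by (auto simp: clamped_cond_def)

lemma measurable_clamped_cond [measurable]: "clamped_cond \<eta> F A \<in> borel_measurable \<eta>"
  unfolding clamped_cond_def by measurable

section \<open>Measurability tested by conditional expectations\<close>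

lemma (in finite_measure_subalgebra) AE_clamped_cond:
  assumes [measurable]: "A \<in> sets M"
  shows "AE x in M. clamped_cond M F A x = real_cond_exp M F (indicator A) x"
proof -
  have i: "integrable M (indicator A :: _ \<Rightarrow> real)" by (rule integrable_const_bound[where B=1]) auto
  have "AE x in M. 0 \<le> real_cond_exp M F (indicator A) x"
    by (rule real_cond_exp_ge_c[OF i]) auto
  moreover have "AE x in M. real_cond_exp M F (indicator A) x \<le> 1"
    by (rule real_cond_exp_le_c[OF i]) auto
  ultimately show ?thesis by eventually_elim (simp add: clamped_cond_def)
qed

text \<open>Both sides express f = E[f | F] almost surely. The right-hand side is linear in f, which
  is what makes causality an affine condition on the plan.\<close>

lemma (in finite_measure_subalgebra) completed_measurable_iff:
  fixes f :: "'a \<Rightarrow> real"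
  assumes f [measurable]: "f \<in> borel_measurable M" and f01: "\<And>x. 0 \<le> f x" "\<And>x. f x \<le> 1"
    and sp: "space M = UNIV"
  shows "(\<forall>D\<in>sets borel. f -` D \<in> completed_sets M (sets F)) \<longleftrightarrow>
    (\<forall>A\<in>sets M. (\<integral>x. f x * indicator A x \<partial>M) = (\<integral>x. clamped_cond M F A x * f x \<partial>M))"
proof -
  have bd: "integrable M g" if "g \<in> borel_measurable M" "AE x in M. \<bar>g x\<bar> \<le> 1" for g :: "_ \<Rightarrow> real"
    using that by (intro integrable_const_bound[where B=1]) auto
  have cond_eq: "(\<integral>x. clamped_cond M F A x * g x \<partial>M) = (\<integral>x. real_cond_exp M F (indicator A) x * g x \<partial>M)"
    if [measurable]: "A \<in> sets M" "g \<in> borel_measurable M" for A g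
    by (rule integral_cong_AE) (use AE_clamped_cond[OF that(1)] in \<open>auto elim: eventually_mono\<close>)
  have int_f: "integrable M f" using f01 by (intro bd) auto
  show ?thesis
  proof
    assume "\<forall>D\<in>sets borel. f -` D \<in> completed_sets M (sets F)"
    then obtain g where g: "g \<in> borel_measurable F" and ae: "AE x in M. f x = g x"
      using AE_subalgebra_measurable[of M F f, OF subalg f01] by blast
    have [measurable]: "g \<in> borel_measurable M" by (rule measurable_from_subalg[OF subalg g])
    show "\<forall>A\<in>sets M. (\<integral>x. f x * indicator A x \<partial>M) = (\<integral>x. clamped_cond M F A x * f x \<partial>M)"
    proof
      fix A assume A [measurable]: "A \<in> sets M"
      have g1: "AE x in M. \<bar>g x\<bar> \<le> 1"
        using ae
      proof eventually_elim
        case (elim x)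
        then show ?case using f01[of x] by simp
      qed
      have ig: "integrable M (\<lambda>x. g x * indicator A x)"
      proof (rule bd)
        show "AE x in M. \<bar>g x * indicator A x\<bar> \<le> 1"
          using g1 by eventually_elim (auto simp: indicator_def)
      qed measurable
      have "(\<integral>x. f x * indicator A x \<partial>M) = (\<integral>x. g x * indicator A x \<partial>M)"
        by (rule integral_cong_AE) (use ae in \<open>auto elim: eventually_mono\<close>)
      also have "\<dots> = (\<integral>x. g x * real_cond_exp M F (indicator A) x \<partial>M)"
        by (rule real_cond_exp_intg(2)[symmetric, OF ig g]) auto
      also have "\<dots> = (\<integral>x. real_cond_exp M F (indicator A) x * f x \<partial>M)"
        by (rule integral_cong_AE) (use ae in \<open>auto elim: eventually_mono\<close>)
      also have "\<dots> = (\<integral>x. clamped_cond M F A x * f x \<partial>M)" using cond_eq[OF A f] by simp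
      finally show "(\<integral>x. f x * indicator A x \<partial>M) = (\<integral>x. clamped_cond M F A x * f x \<partial>M)" .
    qed
  next
    assume eq: "\<forall>A\<in>sets M. (\<integral>x. f x * indicator A x \<partial>M) = (\<integral>x. clamped_cond M F A x * f x \<partial>M)"
    let ?g = "real_cond_exp M F f"
    have g1: "AE x in M. \<bar>?g x\<bar> \<le> 1"
      using real_cond_exp_ge_c[OF int_f, of 0] real_cond_exp_le_c[OF int_f, of 1] f01
      by (auto elim: eventually_elim2)
    have ae: "AE x in M. f x = ?g x"
    proof (rule AE_eqI_integral[OF int_f])
      show "integrable M ?g" by (rule real_cond_exp_int(1)[OF int_f])
      fix A assume A [measurable]: "A \<in> sets M"
      let ?c = "real_cond_exp M F (indicator A)"
      have c1: "AE x in M. \<bar>?c x\<bar> \<le> 1"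
        using AE_clamped_cond[OF A] by eventually_elim (metis clamped_cond_bounds abs_of_nonneg)
      have icf: "integrable M (\<lambda>x. ?c x * f x)"
      proof (rule bd)
        show "AE x in M. \<bar>?c x * f x\<bar> \<le> 1"
          using c1 by eventually_elim (use f01 in \<open>simp add: abs_mult mult_le_one\<close>)
      qed measurable
      have igA: "integrable M (\<lambda>x. ?g x * indicator A x)"
      proof (rule bd)
        show "AE x in M. \<bar>?g x * indicator A x\<bar> \<le> 1"
          using g1 by eventually_elim (auto simp: indicator_def)
      qed measurable
      \<comment> \<open>Self-adjointness in two moves: since \<open>?c\<close> is F-measurable, f
        may be replaced by \<open>?g\<close>; since \<open>?g\<close> is F-measurable,
        \<open>?c\<close> may be replaced by the indicator of A.\<close>
      have "(\<integral>x. f x * indicator A x \<partial>M) = (\<integral>x. ?c x * f x \<partial>M)"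
        using eq A cond_eq[OF A f] by simp
      also have "\<dots> = (\<integral>x. ?c x * ?g x \<partial>M)"
        by (rule real_cond_exp_intg(2)[symmetric, OF icf]) auto
      also have "\<dots> = (\<integral>x. ?g x * ?c x \<partial>M)" by (simp add: mult.commute)
      also have "\<dots> = (\<integral>x. ?g x * indicator A x \<partial>M)"
        by (rule real_cond_exp_intg(2)[OF igA]) auto
      finally show "(\<integral>x. f x * indicator A x \<partial>M) = (\<integral>x. ?g x * indicator A x \<partial>M)" .
    qed
    show "\<forall>D\<in>sets borel. f -` D \<in> completed_sets M (sets F)"
    proof
      fix D :: "real set" assume D: "D \<in> sets borel"
      have spF: "space F = UNIV" using subalg sp by (simp add: subalgebra_def)
      have "?g -` D \<inter> space F \<in> sets F" using D by measurable
      then show "f -` D \<in> completed_sets M (sets F)"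
        by (rule completed_sets_AE_I[OF subalg]) (use ae sp spF in \<open>auto elim: eventually_mono\<close>)
    qed
  qed
qed

section \<open>Causality without the kernel\<close>

context marginals
begin

text \<open>The completed sets form a sigma-field, so inclusion is tested on generators, that is, on
  measurability of x -> \<Theta>^x(C) for each C. \<open>completed_measurable_iff\<close> and
  \<open>plan_integral\<close> then turn this into integrals against \<gamma>, which shows that the
  version chosen by \<open>kernel_of\<close> is immaterial.\<close>

lemma causal_info_subset_iff:
  assumes F: "subalgebra borel F" and S: "subalgebra borel S" and \<gamma>: "\<gamma> \<in> transference_plans \<eta> \<nu>"
  shows "causal_info \<eta> \<nu> S \<gamma> \<subseteq> completed_sets \<eta> (sets F) \<longleftrightarrow>
    (\<forall>C\<in>sets S. measure \<nu> (frontier C) = 0 \<longrightarrow> (\<forall>A\<in>sets borel.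
       measure \<gamma> (A \<times> C) = (\<integral>z. clamped_cond \<eta> F A (fst z) * indicator C (snd z) \<partial>\<gamma>)))"
proof -
  have F': "subalgebra \<eta> F" using F by (simp add: subalgebra_def)
  interpret finite_measure_subalgebra \<eta> F
    by unfold_locales (rule F')
  have SC: "C \<in> sets borel" if "C \<in> sets S" for C using S that by (auto simp: subalgebra_def)
  let ?f = "\<lambda>C x. measure (kernel_of \<eta> \<gamma> x) C"
  let ?G = "{?f C -` D | C D. C \<in> sets S \<and> measure \<nu> (frontier C) = 0 \<and> D \<in> sets (borel :: real measure)}"
  have "causal_info \<eta> \<nu> S \<gamma> \<subseteq> completed_sets \<eta> (sets F) \<longleftrightarrow> ?G \<subseteq> completed_sets \<eta> (sets F)"
  proof
    assume "causal_info \<eta> \<nu> S \<gamma> \<subseteq> completed_sets \<eta> (sets F)"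
    moreover have "?G \<subseteq> causal_info \<eta> \<nu> S \<gamma>"
      unfolding causal_info_def completed_sets_def by (auto intro!: sigma_sets.Basic)
    ultimately show "?G \<subseteq> completed_sets \<eta> (sets F)" by blast
  next
    assume G: "?G \<subseteq> completed_sets \<eta> (sets F)"
    have "sigma_sets UNIV ?G \<subseteq> completed_sets \<eta> (sets F)"
      using sigma_sets_mono[OF G[unfolded completed_sets_def]] by (simp add: completed_sets_def)
    moreover have "{N. \<exists>N'\<in>null_sets \<eta>. N \<subseteq> N'} \<subseteq> completed_sets \<eta> (sets F)"
      unfolding completed_sets_def by (auto intro!: sigma_sets.Basic)
    ultimately have "sigma_sets UNIV ?G \<union> {N. \<exists>N'\<in>null_sets \<eta>. N \<subseteq> N'} \<subseteq> completed_sets \<eta> (sets F)" by simp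
    then show "causal_info \<eta> \<nu> S \<gamma> \<subseteq> completed_sets \<eta> (sets F)"
      unfolding causal_info_def completed_sets_def by (rule sigma_sets_mono)
  qed
  also have "\<dots> \<longleftrightarrow> (\<forall>C\<in>sets S. measure \<nu> (frontier C) = 0 \<longrightarrow>
      (\<forall>D\<in>sets borel. ?f C -` D \<in> completed_sets \<eta> (sets F)))" by blast
  also have "\<dots> \<longleftrightarrow> (\<forall>C\<in>sets S. measure \<nu> (frontier C) = 0 \<longrightarrow> (\<forall>A\<in>sets borel.
       measure \<gamma> (A \<times> C) = (\<integral>z. clamped_cond \<eta> F A (fst z) * indicator C (snd z) \<partial>\<gamma>)))"
  proof (intro ball_cong refl imp_cong)
    fix C assume "C \<in> sets S"
    then have C: "C \<in> sets borel" by (rule SC)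
    note k = kernel_of[OF \<gamma> C]
    have cm: "clamped_cond \<eta> F A \<in> borel_measurable borel" for A
      using measurable_clamped_cond[of \<eta> F A] by (simp cong: measurable_cong_sets)
    have "(\<forall>D\<in>sets borel. ?f C -` D \<in> completed_sets \<eta> (sets F)) \<longleftrightarrow>
      (\<forall>A\<in>sets \<eta>. (\<integral>x. ?f C x * indicator A x \<partial>\<eta>) = (\<integral>x. clamped_cond \<eta> F A x * ?f C x \<partial>\<eta>))"
      by (rule completed_measurable_iff) (use k in \<open>simp_all cong: measurable_cong_sets\<close>)
    also have "\<dots> \<longleftrightarrow> (\<forall>A\<in>sets borel.
       measure \<gamma> (A \<times> C) = (\<integral>z. clamped_cond \<eta> F A (fst z) * indicator C (snd z) \<partial>\<gamma>))"
      by (simp add: k(4) plan_integral[OF \<gamma> C k cm])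
    finally show "(\<forall>D\<in>sets borel. ?f C -` D \<in> completed_sets \<eta> (sets F)) \<longleftrightarrow> (\<forall>A\<in>sets borel.
       measure \<gamma> (A \<times> C) = (\<integral>z. clamped_cond \<eta> F A (fst z) * indicator C (snd z) \<partial>\<gamma>))" .
  qed
  finally show ?thesis .
qed

end

section \<open>The sets of causal plans and causal maps\<close>

lemma measure_mix_measure:
  assumes "sets \<nu> = sets \<mu>" "B \<in> sets \<mu>" "finite_measure \<mu>" "finite_measure \<nu>" "t \<in> {0..1}"
  shows "measure (mix_measure t \<mu> \<nu>) B = t * measure \<mu> B + (1 - t) * measure \<nu> B"
proof -
  have "emeasure (mix_measure t \<mu> \<nu>) B = ennreal (t * measure \<mu> B + (1 - t) * measure \<nu> B)"
    using assms by (simp add: emeasure_mix_measure finite_measure.emeasure_eq_measure ennreal_mult ennreal_plus)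
  then show ?thesis by (rule measure_eq_emeasure_eq_ennreal[rotated]) (use assms in simp)
qed

section \<open>Non-emptiness, convexity and compactness\<close>

context marginals
begin

lemma subalgebra_\<eta>: "subalgebra borel F \<Longrightarrow> subalgebra \<eta> F"
  by (simp add: subalgebra_def)

lemma borel_clamped_cond: "clamped_cond \<eta> F A \<in> borel_measurable borel"
  using measurable_clamped_cond[of \<eta> F A] by (simp cong: measurable_cong_sets)

lemma integral_clamped_cond:
  assumes F: "subalgebra borel F" and A: "A \<in> sets borel"
  shows "(\<integral>x. clamped_cond \<eta> F A x \<partial>\<eta>) = measure \<eta> A"
proof -
  interpret finite_measure_subalgebra \<eta> F
    by unfold_locales (rule subalgebra_\<eta>[OF F])
  have [measurable]: "A \<in> sets \<eta>" using A by simp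
  have "(\<integral>x. clamped_cond \<eta> F A x \<partial>\<eta>) = (\<integral>x. real_cond_exp \<eta> F (indicator A) x \<partial>\<eta>)"
    by (rule integral_cong_AE) (use AE_clamped_cond[of A] A in auto)
  also have "\<dots> = (\<integral>x. indicator A x \<partial>\<eta>)"
    by (rule real_cond_exp_int(2)) (auto intro!: \<eta>.integrable_const_bound[where B=1])
  finally show ?thesis by simp
qed

lemma causal_plans_iff:
  assumes E: "borel_filtration I \<E>" and S: "borel_filtration I \<S>"
  shows "\<gamma> \<in> causal_plans I \<E> \<S> \<eta> \<nu> \<longleftrightarrow> \<gamma> \<in> transference_plans \<eta> \<nu> \<and>
    (\<forall>t\<in>I. \<forall>C\<in>sets (\<S> t). measure \<nu> (frontier C) = 0 \<longrightarrow> (\<forall>A\<in>sets borel.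
       measure \<gamma> (A \<times> C) = (\<integral>z. clamped_cond \<eta> (\<E> t) A (fst z) * indicator C (snd z) \<partial>\<gamma>)))"
proof -
  have "causal_info \<eta> \<nu> (\<S> t) \<gamma> \<subseteq> completed_sets \<eta> (sets (\<E> t)) \<longleftrightarrow>
    (\<forall>C\<in>sets (\<S> t). measure \<nu> (frontier C) = 0 \<longrightarrow> (\<forall>A\<in>sets borel.
       measure \<gamma> (A \<times> C) = (\<integral>z. clamped_cond \<eta> (\<E> t) A (fst z) * indicator C (snd z) \<partial>\<gamma>)))"
    if "\<gamma> \<in> transference_plans \<eta> \<nu>" "t \<in> I" for t
    using E S that by (intro causal_info_subset_iff) (auto simp: borel_filtration_def)
  then show ?thesis by (simp add: causal_plans_def cong: conj_cong ball_cong)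
qed

lemma borel_filtration_sets:
  "borel_filtration I \<S> \<Longrightarrow> t \<in> I \<Longrightarrow> C \<in> sets (\<S> t) \<Longrightarrow> C \<in> sets borel"
  by (auto simp: borel_filtration_def subalgebra_def)

text \<open>Independence makes the kernel constantly \<open>\<nu>\<close>, and conditioning the
  indicator of A preserves its mean, so both sides of each equation are
  \<open>measure \<eta> A * measure \<nu> C\<close>.\<close>

lemma pair_measure_in_causal_plans:
  assumes E: "borel_filtration I \<E>" and S: "borel_filtration I \<S>"
  shows "\<eta> \<Otimes>\<^sub>M \<nu> \<in> causal_plans I \<E> \<S> \<eta> \<nu>"
proof -
  interpret P: pair_prob_space \<eta> \<nu> ..
  have "sets (\<eta> \<Otimes>\<^sub>M \<nu>) = sets (borel \<Otimes>\<^sub>M borel)" by (rule sets_pair_measure_cong) auto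
  then have s: "sets (\<eta> \<Otimes>\<^sub>M \<nu>) = sets borel" by (simp only: sets_borel_pair)
  have rect: "measure (\<eta> \<Otimes>\<^sub>M \<nu>) (A \<times> B) = measure \<eta> A * measure \<nu> B"
    if "A \<in> sets borel" "B \<in> sets borel" for A B
    using that by (simp add: measure_def \<nu>.emeasure_pair_measure_Times enn2real_mult)
  have plan: "\<eta> \<Otimes>\<^sub>M \<nu> \<in> transference_plans \<eta> \<nu>"
    using s rect \<nu>.prob_space \<eta>.prob_space by (simp add: plan_iff P.prob_space_axioms)
  show ?thesis
    unfolding causal_plans_iff[OF E S]
  proof (intro conjI plan ballI impI)
    fix t and C :: "'s set" and A :: "'e set" assume t: "t \<in> I" "C \<in> sets (\<S> t)" and A: "A \<in> sets borel"
    have C: "C \<in> sets borel" by (rule borel_filtration_sets[OF S t])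
    have F: "subalgebra borel (\<E> t)" using E t by (simp add: borel_filtration_def)
    have "(\<integral>z. clamped_cond \<eta> (\<E> t) A (fst z) * indicator C (snd z) \<partial>(\<eta> \<Otimes>\<^sub>M \<nu>)) =
      (\<integral>x. clamped_cond \<eta> (\<E> t) A x * measure \<nu> C \<partial>\<eta>)"
      by (rule plan_integral[OF plan C]) (use rect C in \<open>auto simp: borel_clamped_cond\<close>)
    also have "\<dots> = measure (\<eta> \<Otimes>\<^sub>M \<nu>) (A \<times> C)"
      using integral_clamped_cond[OF F A] rect[OF A C] by simp
    finally show "measure (\<eta> \<Otimes>\<^sub>M \<nu>) (A \<times> C) =
      (\<integral>z. clamped_cond \<eta> (\<E> t) A (fst z) * indicator C (snd z) \<partial>(\<eta> \<Otimes>\<^sub>M \<nu>))" by simp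
  qed
qed

text \<open>The integrals in the causality equations are affine in the plan. They are evaluated on
  the marginal \<open>\<eta>\<close>, where mixing plans means mixing their kernel
  functions.\<close>

lemma convex_causal_plans:
  assumes E: "borel_filtration I \<E>" and S: "borel_filtration I \<S>"
  shows "convex_measures (causal_plans I \<E> \<S> \<eta> \<nu>)"
  unfolding convex_measures_def
proof (intro ballI)
  fix \<gamma> \<gamma>' and t :: real
  assume c: "\<gamma> \<in> causal_plans I \<E> \<S> \<eta> \<nu>" "\<gamma>' \<in> causal_plans I \<E> \<S> \<eta> \<nu>" and t: "t \<in> {0..1}"
  then have p: "\<gamma> \<in> transference_plans \<eta> \<nu>" "\<gamma>' \<in> transference_plans \<eta> \<nu>"
    by (auto simp: causal_plans_def)
  then have s: "sets \<gamma> = sets borel" "sets \<gamma>' = sets borel" and ps: "prob_space \<gamma>" "prob_space \<gamma>'"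
    by (auto simp: plan_iff)
  interpret \<gamma>: prob_space \<gamma> by fact
  interpret \<gamma>': prob_space \<gamma>' by fact
  let ?m = "mix_measure t \<gamma> \<gamma>'"
  have m: "measure ?m X = t * measure \<gamma> X + (1 - t) * measure \<gamma>' X" if "X \<in> sets borel" for X
    using that s t by (intro measure_mix_measure) (auto simp: \<gamma>.finite_measure_axioms \<gamma>'.finite_measure_axioms)
  have sm: "space ?m = UNIV" "space \<gamma> = UNIV" "space \<gamma>' = UNIV"
    using s sets_eq_imp_space_eq[of _ "borel :: ('e \<times> 's) measure"] by auto
  have "emeasure ?m (space ?m) = ennreal t * emeasure \<gamma> (space \<gamma>) + ennreal (1 - t) * emeasure \<gamma>' (space \<gamma>')"
    using s unfolding sm by (subst emeasure_mix_measure) auto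
  also have "\<dots> = 1"
    using t by (simp add: \<gamma>.emeasure_space_1 \<gamma>'.emeasure_space_1 flip: ennreal_plus)
  finally have "prob_space ?m" by (rule prob_spaceI)
  moreover have "measure ?m (A \<times> UNIV) = measure \<eta> A" if "A \<in> sets borel" for A
    using that p by (simp add: m borel_rect plan_iff algebra_simps)
  moreover have "measure ?m (UNIV \<times> B) = measure \<nu> B" if "B \<in> sets borel" for B
    using that p by (simp add: m borel_rect plan_iff algebra_simps)
  ultimately have pm: "?m \<in> transference_plans \<eta> \<nu>" using s by (simp add: plan_iff)
  show "?m \<in> causal_plans I \<E> \<S> \<eta> \<nu>"
    unfolding causal_plans_iff[OF E S]
  proof (intro conjI pm ballI impI)
    fix i and C :: "'s set" and A :: "'e set"
    assume i: "i \<in> I" "C \<in> sets (\<S> i)" and \<nu>C: "measure \<nu> (frontier C) = 0" and A: "A \<in> sets borel"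
    have C: "C \<in> sets borel" by (rule borel_filtration_sets[OF S i])
    let ?h = "clamped_cond \<eta> (\<E> i) A"
    note k = kernel_of[OF p(1) C] and k' = kernel_of[OF p(2) C]
    let ?f = "\<lambda>x. measure (kernel_of \<eta> \<gamma> x) C" and ?f' = "\<lambda>x. measure (kernel_of \<eta> \<gamma>' x) C"
    have [measurable]: "?f \<in> borel_measurable borel" "?f' \<in> borel_measurable borel" "?h \<in> borel_measurable borel"
      using k(1) k'(1) borel_clamped_cond by auto
    have int: "integrable \<eta> (\<lambda>x. f x * g x)"
      if "f \<in> borel_measurable borel" "g \<in> borel_measurable borel" "\<And>x. 0 \<le> f x \<and> f x \<le> 1" "\<And>x. 0 \<le> g x \<and> g x \<le> 1"
      for f g :: "'e \<Rightarrow> real"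
      using that by (intro \<eta>.integrable_const_bound[where B=1])
        (auto simp: abs_mult intro!: mult_le_one cong: measurable_cong_sets)
    have mixf: "0 \<le> t * ?f x + (1 - t) * ?f' x" "t * ?f x + (1 - t) * ?f' x \<le> 1" for x
      using t k(2,3)[of x] k'(2,3)[of x] convex_bound_le[of "?f x" 1 "?f' x" t "1 - t"] by auto
    have lin: "(\<integral>x. (t * ?f x + (1 - t) * ?f' x) * g x \<partial>\<eta>) = t * (\<integral>x. ?f x * g x \<partial>\<eta>) + (1 - t) * (\<integral>x. ?f' x * g x \<partial>\<eta>)"
      if "g \<in> borel_measurable borel" "\<And>x. 0 \<le> g x \<and> g x \<le> 1" for g :: "'e \<Rightarrow> real"
      using int[OF k(1) that(1)] int[OF k'(1) that(1)] k(2,3) k'(2,3) that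
      by (simp add: distrib_right mult.assoc)
    \<comment> \<open>The mixture of the two kernel functions is a valid density for the mixed plan,
      so its own \<open>kernel_of\<close> never has to be identified.\<close>
    have "(\<integral>z. ?h (fst z) * indicator C (snd z) \<partial>?m) = (\<integral>x. ?h x * (t * ?f x + (1 - t) * ?f' x) \<partial>\<eta>)"
    proof (rule plan_integral[OF pm C _ mixf])
      fix A :: "'e set" assume A: "A \<in> sets borel"
      show "measure ?m (A \<times> C) = (\<integral>x. (t * ?f x + (1 - t) * ?f' x) * indicator A x \<partial>\<eta>)"
        using A C by (subst lin) (auto simp: m borel_rect k(4) k'(4))
    qed measurable
    also have "\<dots> = t * (\<integral>x. ?h x * ?f x \<partial>\<eta>) + (1 - t) * (\<integral>x. ?h x * ?f' x \<partial>\<eta>)"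
      using lin[of ?h] by (simp add: mult.commute clamped_cond_bounds)
    also have "(\<integral>x. ?h x * ?f x \<partial>\<eta>) = (\<integral>z. ?h (fst z) * indicator C (snd z) \<partial>\<gamma>)"
      by (rule plan_integral[OF p(1) C k borel_clamped_cond, symmetric])
    also have "(\<integral>x. ?h x * ?f' x \<partial>\<eta>) = (\<integral>z. ?h (fst z) * indicator C (snd z) \<partial>\<gamma>')"
      by (rule plan_integral[OF p(2) C k' borel_clamped_cond, symmetric])
    also have "(\<integral>z. ?h (fst z) * indicator C (snd z) \<partial>\<gamma>) = measure \<gamma> (A \<times> C)"
      using c(1) i \<nu>C A unfolding causal_plans_iff[OF E S] by simp
    also have "(\<integral>z. ?h (fst z) * indicator C (snd z) \<partial>\<gamma>') = measure \<gamma>' (A \<times> C)"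
      using c(2) i \<nu>C A unfolding causal_plans_iff[OF E S] by simp
    also have "t * measure \<gamma> (A \<times> C) + (1 - t) * measure \<gamma>' (A \<times> C) = measure ?m (A \<times> C)"
      using A C by (simp add: m borel_rect)
    finally show "measure ?m (A \<times> C) = (\<integral>z. ?h (fst z) * indicator C (snd z) \<partial>?m)" by simp
  qed
qed

lemma compactin_causal_plans:
  assumes E: "borel_filtration I \<E>" and S: "borel_filtration I \<S>"
  shows "compactin weak_topology (causal_plans I \<E> \<S> \<eta> \<nu>)"
proof -
  define W where "W = {(clamped_cond \<eta> (\<E> t) A, A, C) | t A C.
     t \<in> I \<and> C \<in> sets (\<S> t) \<and> measure \<nu> (frontier C) = 0 \<and> A \<in> sets borel}"
  have "causal_plans I \<E> \<S> \<eta> \<nu> = {\<gamma> \<in> transference_plans \<eta> \<nu>.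
     \<forall>(h, A, C)\<in>W. measure \<gamma> (A \<times> C) = (\<integral>z. h (fst z) * indicator C (snd z) \<partial>\<gamma>)}"
    unfolding set_eq_iff causal_plans_iff[OF E S] W_def by blast
  moreover have "compactin weak_topology {\<gamma> \<in> transference_plans \<eta> \<nu>.
     \<forall>(h, A, C)\<in>W. measure \<gamma> (A \<times> C) = (\<integral>z. h (fst z) * indicator C (snd z) \<partial>\<gamma>)}"
    by (rule compactin_plans)
       (auto simp: W_def borel_clamped_cond clamped_cond_bounds borel_filtration_sets[OF S])
  ultimately show ?thesis by simp
qed

section \<open>Graph plans under convergence in probability\<close>

lemma integral_graph_plan:
  fixes f :: "('e \<times> 's) \<Rightarrow>\<^sub>C real"
  assumes c: "c \<in> L0 \<eta>"
  shows "graph_plan \<eta> c \<in> borel_probs"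
    and "(\<integral>z. f z \<partial>graph_plan \<eta> c) = (\<integral>x. f (x, rep c x) \<partial>completion \<eta>)"
    and "(\<lambda>x. f (x, rep c x)) \<in> borel_measurable (completion \<eta>)"
proof -
  interpret P: prob_space "completion \<eta>" by (rule prob_space_completion[OF \<eta>.prob_space_axioms])
  have [measurable]: "(\<lambda>x. x) \<in> completion \<eta> \<rightarrow>\<^sub>M borel"
    by (intro measurable_completion) (simp add: measurable_ident_sets)
  have [measurable]: "rep c \<in> completion \<eta> \<rightarrow>\<^sub>M borel" using c by (auto intro: L0_measurable rep_in)
  have g: "(\<lambda>x. (x, rep c x)) \<in> completion \<eta> \<rightarrow>\<^sub>M borel" by (simp add: borel_prod[symmetric])
  have f: "apply_bcontfun f \<in> borel_measurable borel"
    by (rule borel_measurable_continuous_onI[OF continuous_on_apply_bcontfun])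
  show "graph_plan \<eta> c \<in> borel_probs"
    using P.prob_space_distr[OF g] by (simp add: borel_probs_iff graph_plan_def)
  show "(\<integral>z. f z \<partial>graph_plan \<eta> c) = (\<integral>x. f (x, rep c x) \<partial>completion \<eta>)"
    unfolding graph_plan_def by (rule integral_distr[OF g f])
  show "(\<lambda>x. f (x, rep c x)) \<in> borel_measurable (completion \<eta>)"
    by (rule measurable_compose[OF g f])
qed

text \<open>Convergence in probability yields an almost surely convergent subsequence, to which
  dominated convergence applies; a subsequence is enough to show that a limit stays in a closed
  set.\<close>

lemma graph_plan_limit:
  fixes cs :: "nat \<Rightarrow> ('e \<Rightarrow> 's) set"
  assumes lim: "limitin (L0_topology \<eta>) cs c sequentially" and cs: "\<And>n. cs n \<in> L0 \<eta>"
  obtains r where "strict_mono r" "limitin weak_topology (\<lambda>n. graph_plan \<eta> (cs (r n))) (graph_plan \<eta> c) sequentially"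
proof -
  interpret P: prob_space "completion \<eta>" by (rule prob_space_completion[OF \<eta>.prob_space_axioms])
  interpret M: Metric_space "L0 \<eta>" "L0_dist \<eta> :: ('e \<Rightarrow> 's) set \<Rightarrow> _" by (rule Metric_space_L0[OF \<eta>.prob_space_axioms])
  have c: "c \<in> L0 \<eta>" and d: "(\<lambda>n. L0_dist \<eta> (cs n) c) \<longlonglongrightarrow> 0"
    using lim unfolding L0_topology_def M.limitin_metric_dist_null by auto
  let ?u = "\<lambda>n x. min 1 (dist (rep (cs n) x) (rep c x))"
  obtain r where r: "strict_mono r" "AE x in completion \<eta>. (\<lambda>n. ?u (r n) x) \<longlonglongrightarrow> 0"
    using tendsto_L1_AE_subseq[of "completion \<eta>" ?u] d integrable_L0_dist[OF \<eta>.prob_space_axioms cs c]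
    by (auto simp: L0_dist_def)
  from r(2) have conv: "AE x in completion \<eta>. (\<lambda>n. rep (cs (r n)) x) \<longlonglongrightarrow> rep c x"
  proof eventually_elim
    case (elim x)
    \<comment> \<open>Once the truncated distance is below 1, the truncation is inactive and the
      true distance converges.\<close>
    have "\<forall>\<^sub>F n in sequentially. ?u (r n) x < 1" using order_tendstoD(2)[OF elim] by simp
    then have "\<forall>\<^sub>F n in sequentially. ?u (r n) x = dist (rep (cs (r n)) x) (rep c x)"
      by eventually_elim auto
    then have "(\<lambda>n. dist (rep (cs (r n)) x) (rep c x)) \<longlonglongrightarrow> 0" using elim by (rule Lim_transform_eventually[rotated])
    then show ?case by (rule tendsto_dist_iff[THEN iffD2])
  qed
  have "limitin weak_topology (\<lambda>n. graph_plan \<eta> (cs (r n))) (graph_plan \<eta> c) sequentially"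
    unfolding limitin_weak_topology_iff
  proof (intro conjI allI always_eventually)
    fix f :: "('e \<times> 's) \<Rightarrow>\<^sub>C real"
    have "(\<lambda>n. \<integral>x. f (x, rep (cs (r n)) x) \<partial>completion \<eta>) \<longlonglongrightarrow> (\<integral>x. f (x, rep c x) \<partial>completion \<eta>)"
    proof (rule integral_dominated_convergence[where w="\<lambda>_. norm f"])
      show "AE x in completion \<eta>. (\<lambda>n. f (x, rep (cs (r n)) x)) \<longlonglongrightarrow> f (x, rep c x)"
        using conv
      proof eventually_elim
        case (elim x)
        show ?case
          by (rule continuous_on_tendsto_compose[OF continuous_on_apply_bcontfun[of UNIV f]])
             (auto intro!: tendsto_intros elim)
      qed
      show "AE x in completion \<eta>. norm (f (x, rep (cs (r n)) x)) \<le> norm f" for n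
        by (intro AE_I2 norm_bounded)
    qed (auto intro!: integral_graph_plan(3) c cs)
    then show "(\<lambda>n. \<integral>z. f z \<partial>graph_plan \<eta> (cs (r n))) \<longlonglongrightarrow> (\<integral>z. f z \<partial>graph_plan \<eta> c)"
      by (simp add: integral_graph_plan(2) c cs)
  qed (auto intro: integral_graph_plan(1) c cs)
  then show thesis using that r(1) by blast
qed

lemma closedin_causal_maps:
  assumes E: "borel_filtration I \<E>" and S: "borel_filtration I \<S>"
  shows "closedin (subtopology (L0_topology \<eta>) (R_maps \<eta> \<nu>)) (causal_maps I \<E> \<S> \<eta> \<nu>)"
proof -
  interpret M: Metric_space "L0 \<eta>" "L0_dist \<eta> :: ('e \<Rightarrow> 's) set \<Rightarrow> _" by (rule Metric_space_L0[OF \<eta>.prob_space_axioms])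
  have cl: "closedin weak_topology (causal_plans I \<E> \<S> \<eta> \<nu>)"
    by (rule compactin_imp_closedin[OF Hausdorff_weak_topology compactin_causal_plans[OF E S]])
  \<comment> \<open>This set is already closed in all of \<open>L0 \<eta>\<close>; relative
    closedness follows by intersecting with \<open>R_maps \<eta> \<nu>\<close>.\<close>
  define T where "T = {c \<in> L0 \<eta>. graph_plan \<eta> c \<in> causal_plans I \<E> \<S> \<eta> \<nu>}"
  have "closedin M.mtopology T"
    unfolding M.metric_closedin_iff_sequentially_closed
  proof (intro conjI allI impI)
    fix cs c assume *: "range cs \<subseteq> T \<and> limitin M.mtopology cs c sequentially"
    then have cs: "cs n \<in> L0 \<eta>" "graph_plan \<eta> (cs n) \<in> causal_plans I \<E> \<S> \<eta> \<nu>" for n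
      by (auto simp: T_def)
    have lim: "limitin (L0_topology \<eta>) cs c sequentially" using * by (simp add: L0_topology_def)
    obtain r where r: "limitin weak_topology (\<lambda>n. graph_plan \<eta> (cs (r n))) (graph_plan \<eta> c) sequentially"
      using graph_plan_limit[OF lim cs(1)] by blast
    have "graph_plan \<eta> c \<in> causal_plans I \<E> \<S> \<eta> \<nu>"
      by (rule limitin_closedin[OF r cl]) (auto simp: cs)
    moreover have "c \<in> L0 \<eta>" using * M.limitin_mspace by blast
    ultimately show "c \<in> T" by (simp add: T_def)
  qed (auto simp: T_def)
  moreover have "causal_maps I \<E> \<S> \<eta> \<nu> = T \<inter> R_maps \<eta> \<nu>"
    by (auto simp: causal_maps_def T_def R_maps_def)
  ultimately show ?thesis unfolding closedin_subtopology L0_topology_def by blast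
qed

end

theorem theorem1:
  fixes I :: "'i::linorder set"
    and \<E> :: "'i \<Rightarrow> 'e::polish_space measure"
    and \<S> :: "'i \<Rightarrow> 's::polish_space measure"
    and \<eta> :: "'e measure" and \<nu> :: "'s measure"
  assumes "borel_filtration I \<E>" and "borel_filtration I \<S>"
    and "\<eta> \<in> borel_probs" and "\<nu> \<in> borel_probs"
  shows "(causal_plans I \<E> \<S> \<eta> \<nu> \<noteq> {} \<and>
          convex_measures (causal_plans I \<E> \<S> \<eta> \<nu>) \<and>
          compactin weak_topology (causal_plans I \<E> \<S> \<eta> \<nu>)) \<and>
         closedin (subtopology (L0_topology \<eta>) (R_maps \<eta> \<nu>)) (causal_maps I \<E> \<S> \<eta> \<nu>)"
proof -
  interpret marginals \<eta> \<nu> using assms(3,4) by (rule marginals.intro)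
  show ?thesis
    using pair_measure_in_causal_plans[OF assms(1,2)] convex_causal_plans[OF assms(1,2)]
      compactin_causal_plans[OF assms(1,2)] closedin_causal_maps[OF assms(1,2)] by blast
qed

end
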